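(* For odd $n\ge 3$, the graph $\mathcal{H}_n$ has maximum degree $n$, and there are exactly two vertices of degree $n$, namely the two matchings in $\mathcal{M}_n$ all of whose edges are perimeter edges. For even $n\ge 2$, the graph $\mathcal{H}_n$ has maximum degree $n/2$.
   Context: Fix an integer $n\ge 2$ and place $2n$ points equidistantly on the unit circle. $\mathcal{M}_n$ is the set of all non-crossing straight-line perfect matchings on these $2n$ points (each has $n$ edges). For $M\in\mathcal{M}_n$, two edges $e,f\in M$ span an empty quadrilateral if the convex hull of $e$ and $f$ contains no other edge of $M$; replacing $e,f$ by the other two edges of this quadrilateral yields another matching of $\mathcal{M}_n$ (a flip). A flip is centered if the closed quadrilateral contains the center of the circle (possibly on its boundary). $\mathcal{H}_n$ is the graph with vertex set $\mathcal{M}_n$ and an edge between two matchings if they differ by a centered flip. For $e\in M$, the length $\ell(e)$ is the minimum, over the two sides of the line through $e$, of the number of other edges of $M$ lying on that side; $e$ is a perimeter edge if $\ell(e)=0$. *)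

theory Defs
  imports "HOL-Analysis.Analysis"
begin

definition circle_points :: "nat \<Rightarrow> complex set" where
  "circle_points n = (\<lambda>k. cis (2 * pi * real k / real (2 * n))) ` {..<2 * n}"

text \<open>An edge is represented by the set of its two endpoints; the straight-line segment it
  stands for is the convex hull of that set.\<close>

definition matchings :: "nat \<Rightarrow> complex set set set" where
  "matchings n = {M.
     (\<forall>e\<in>M. e \<subseteq> circle_points n \<and> card e = 2) \<and>
     (\<forall>p\<in>circle_points n. \<exists>!e. e \<in> M \<and> p \<in> e) \<and>
     (\<forall>e\<in>M. \<forall>f\<in>M. e \<noteq> f \<longrightarrow> convex hull e \<inter> convex hull f = {})}"

text \<open>All endpoints lie on the circle, so the quadrilateral can never contain both endpoints of a
  third edge. That it contains no other edge therefore has to mean that no other edge meets it,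
  i.e. that no other edge passes between the two given ones.\<close>

definition empty_quadrilateral :: "complex set set \<Rightarrow> complex set \<Rightarrow> complex set \<Rightarrow> bool" where
  "empty_quadrilateral M e f \<longleftrightarrow>
     e \<in> M \<and> f \<in> M \<and> e \<noteq> f \<and>
     (\<forall>g\<in>M - {e, f}. convex hull g \<inter> convex hull (e \<union> f) = {})"

definition quadrilateral_sides :: "complex set \<Rightarrow> complex set \<Rightarrow> complex set set" where
  "quadrilateral_sides e f =
     {g. g \<subseteq> e \<union> f \<and> card g = 2 \<and> (convex hull g) edge_of (convex hull (e \<union> f))}"

definition flip :: "complex set set \<Rightarrow> complex set \<Rightarrow> complex set \<Rightarrow> complex set set" where
  "flip M e f = (M - {e, f}) \<union> (quadrilateral_sides e f - {e, f})"

definition centered_flip :: "complex set set \<Rightarrow> complex set set \<Rightarrow> bool" where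
  "centered_flip M M' \<longleftrightarrow>
     (\<exists>e f. empty_quadrilateral M e f \<and> 0 \<in> convex hull (e \<union> f) \<and> M' = flip M e f)"

definition H_edges :: "nat \<Rightarrow> complex set set set set" where
  "H_edges n = {{M, M'} | M M'. M \<in> matchings n \<and> M' \<in> matchings n \<and> centered_flip M M'}"

definition vertex_degree :: "'v set set \<Rightarrow> 'v \<Rightarrow> nat" where
  "vertex_degree E v = card {x \<in> E. v \<in> x}"

definition max_degree :: "'v set \<Rightarrow> 'v set set \<Rightarrow> nat" where
  "max_degree V E = Max (vertex_degree E ` V)"

text \<open>The open half-plane to the left of the directed line from \<open>a\<close> to \<open>b\<close>.\<close>

definition left_side :: "complex \<Rightarrow> complex \<Rightarrow> complex set" where
  "left_side a b = {z. Im ((z - a) * cnj (b - a)) > 0}"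

text \<open>The two orderings of the endpoints of \<open>e\<close> give the two sides of the line through \<open>e\<close>.\<close>

definition edge_length :: "complex set set \<Rightarrow> complex set \<Rightarrow> nat" where
  "edge_length M e =
     Min {card {f \<in> M - {e}. convex hull f \<subseteq> left_side a b} | a b. e = {a, b}}"

definition perimeter_edge :: "complex set set \<Rightarrow> complex set \<Rightarrow> bool" where
  "perimeter_edge M e \<longleftrightarrow> e \<in> M \<and> edge_length M e = 0"

end

theory Submission
  imports Defs
begin

text \<open>
  Project each edge from the center onto the circle; call the set of polygon vertices it covers its
  shadow. Two edges \<open>e\<close>, \<open>f\<close> admit a centered flip only if some vertex in the shadow of \<open>e\<close> has its
  antipode in the shadow of \<open>f\<close>; for even \<open>n\<close> there are at least two such vertices, since otherwise
  the flip would create an edge through the center, leaving the odd number \<open>n - 1\<close> of points on each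
  side. If no edge of the matching contains the center, emptiness of the quadrilaterals forces these
  vertex sets to be disjoint for different ordered pairs \<open>(e, f)\<close>, and counting the \<open>2 n\<close> vertices
  bounds the degree by \<open>n\<close>, respectively \<open>n / 2\<close>. If some edge \<open>d\<close> contains the center, every centered
  flip uses \<open>d\<close>, so there are at most \<open>n - 1\<close> of them. Degree \<open>n\<close> makes every one of the vertex sets a
  singleton and their union the whole circle. An edge with a vertex strictly inside its shadow would
  then face three consecutive vertices belonging to three different edges, although the shadow of the
  middle one has to contain a neighbour. Hence all edges are sides of the polygon, and for the two
  matchings consisting of sides the bound is attained.
\<close>

section \<open>Orientation and chords of a regular polygon\<close>

text \<open>Twice the signed area of the triangle \<open>a b z\<close>, positive when
  \<open>z\<close> lies to the left of the line from \<open>a\<close> to \<open>b\<close>. It is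
  affine in \<open>z\<close>, so sign conditions on points pass to their convex hull.\<close>

definition ori :: "complex \<Rightarrow> complex \<Rightarrow> complex \<Rightarrow> real" where
  "ori a b z = Im ((z - a) * cnj (b - a))"

lemma left_side_ori: "left_side a b = {z. ori a b z > 0}"
  by (simp add: left_side_def ori_def)

lemma ori_affine:
  assumes "u + v = 1"
  shows "ori a b (u *\<^sub>R x + v *\<^sub>R y) = u * ori a b x + v * ori a b y"
proof -
  have v: "v = 1 - u" using assms by simp
  show ?thesis unfolding v by (simp add: ori_def algebra_simps)
qed

lemma ori_swap: "ori b a c = - ori a b c"
  by (simp add: ori_def algebra_simps)

lemma ori_endpoints [simp]: "ori a b a = 0" "ori a b b = 0"
  by (simp_all add: ori_def algebra_simps)

lemma convex_ori_pos: "convex {z. ori a b z > 0}"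
proof (rule convexI, clarsimp)
  fix x y and u v :: real
  assume "0 < ori a b x" "0 < ori a b y" "0 \<le> u" "0 \<le> v" "u + v = 1"
  then show "0 < ori a b (u *\<^sub>R x + v *\<^sub>R y)"
    unfolding ori_affine[OF \<open>u + v = 1\<close>]
    by (cases "u = 0") (auto intro: add_pos_nonneg)
qed

lemma convex_ori_nonpos: "convex {z. ori a b z \<le> 0}"
proof (rule convexI, clarsimp)
  fix x y and u v :: real
  assume "ori a b x \<le> 0" "ori a b y \<le> 0" "0 \<le> u" "0 \<le> v" "u + v = 1"
  then show "ori a b (u *\<^sub>R x + v *\<^sub>R y) \<le> 0"
    unfolding ori_affine[OF \<open>u + v = 1\<close>]
    by (simp add: add_nonpos_nonpos mult_nonneg_nonpos)
qed

lemma hull_ori_pos: "(\<And>x. x \<in> S \<Longrightarrow> ori a b x > 0) \<Longrightarrow> convex hull S \<subseteq> {z. ori a b z > 0}"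
  by (rule hull_minimal) (auto intro: convex_ori_pos)

lemma hull_ori_nonpos: "(\<And>x. x \<in> S \<Longrightarrow> ori a b x \<le> 0) \<Longrightarrow> convex hull S \<subseteq> {z. ori a b z \<le> 0}"
  by (rule hull_minimal) (auto intro: convex_ori_nonpos)

text \<open>The line through \<open>a\<close> and \<open>b\<close> separates the two hulls:
  \<open>ori a b\<close> is at most 0 on the segment and positive on the hull of
  \<open>T\<close>.\<close>

lemma hulls_disjoint_ori:
  assumes "\<And>x. x \<in> T \<Longrightarrow> ori a b x > 0"
  shows "convex hull {a, b} \<inter> convex hull T = {}"
proof -
  have "convex hull {a, b} \<subseteq> {z. ori a b z \<le> 0}" by (rule hull_ori_nonpos) auto
  moreover have "convex hull T \<subseteq> {z. ori a b z > 0}" by (rule hull_ori_pos) (rule assms)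
  ultimately show ?thesis by fastforce
qed

text \<open>The area of a triangle inscribed in the unit circle factors into sines of half angle
  differences. This turns orientation into a question about the order of the angles.\<close>

lemma ori_cis:
  "ori (cis x) (cis y) (cis z) = 4 * sin ((y - x) / 2) * sin ((z - y) / 2) * sin ((z - x) / 2)"
proof -
  define u w where "u = (y - x) / 2" and "w = (z - y) / 2"
  have y: "y = x + 2 * u" and z: "z = y + 2 * w" by (simp_all add: u_def w_def diff_divide_distrib)
  have zx: "(z - x) / 2 = u + w" by (simp add: u_def w_def field_simps)
  have "ori (cis x) (cis y) (cis z) = sin (y - x) + sin (z - y) - sin (z - x)"
    by (simp add: ori_def algebra_simps sin_diff)
  also have "\<dots> = sin (2 * u) + sin (2 * w) - sin (2 * u + 2 * w)"
    by (simp add: y z)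
  also have "\<dots> = sin (2 * u) * (1 - cos (2 * w)) + sin (2 * w) * (1 - cos (2 * u))"
    by (simp add: sin_add algebra_simps)
  also have "\<dots> = 4 * sin u * sin w * (sin u * cos w + cos u * sin w)"
    by (simp only: sin_double cos_double_sin power2_eq_square) (simp add: algebra_simps)
  finally show ?thesis unfolding zx by (simp add: u_def w_def sin_add)
qed

section \<open>Vertices of the regular polygon, indexed by integers modulo
  \<open>2 * n\<close>\<close>

definition vtx :: "nat \<Rightarrow> int \<Rightarrow> complex" where
  "vtx n k = cis (pi * of_int k / of_nat n)"

locale polygon =
  fixes n :: nat
  assumes n2: "n \<ge> 2"
begin

abbreviation P :: "int \<Rightarrow> complex" where "P \<equiv> vtx n"

lemma vtx_eq_iff: "P i = P j \<longleftrightarrow> 2 * int n dvd i - j"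
proof -
  have npos: "real n > 0" using n2 by simp
  have "P i = P j \<longleftrightarrow> cis (pi * of_int i / n - pi * of_int j / n) = 1"
    by (simp add: vtx_def flip: cis_divide)
  also have "\<dots> \<longleftrightarrow> (\<exists>k::int. pi * of_int i / n - pi * of_int j / n = of_int k * (2 * pi))"
    by (simp add: complex_eq_iff) (metis cos_one_2pi_int cos_one_sin_zero mult.assoc)
  also have "\<dots> \<longleftrightarrow> (\<exists>k::int. real_of_int (i - j) = of_int (2 * int n * k))"
    using npos by (intro ex_cong1) (simp add: field_simps, metis (no_types, opaque_lifting) distrib_left mult_cancel_left pi_neq_zero mult.assoc mult.commute)
  also have "\<dots> \<longleftrightarrow> 2 * int n dvd i - j"
    unfolding of_int_eq_iff dvd_def ..
  finally show ?thesis .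
qed

lemma vtx_periodic [simp]: "P (i + 2 * int n) = P i"
  by (simp add: vtx_eq_iff)

lemma vtx_neq: "i < j \<Longrightarrow> j < i + 2 * int n \<Longrightarrow> P i \<noteq> P j"
  unfolding vtx_eq_iff using zdvd_not_zless[of "j - i" "2 * int n"]
  by (metis dvd_minus_iff minus_diff_eq diff_gt_0_iff_gt less_diff_eq add.commute diff_less_eq)

lemma vtx_antipode: "P (i + int n) = - P i"
proof -
  have "pi * of_int (i + int n) / n = pi * of_int i / n + pi" using n2 by (simp add: field_simps)
  then show ?thesis by (simp add: vtx_def complex_eq_iff)
qed

lemma circle_points_range: "circle_points n = range P"
proof -
  have "cis (2 * pi * real k / real (2 * n)) = P (int k)" for k
    using n2 by (simp add: vtx_def)
  then have *: "circle_points n = (\<lambda>k. P (int k)) ` {..<2 * n}" by (simp add: circle_points_def)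
  have "P i \<in> (\<lambda>k. P (int k)) ` {..<2 * n}" for i
  proof (rule image_eqI)
    show "P i = P (int (nat (i mod (2 * int n))))"
      using n2 by (simp add: vtx_eq_iff mod_eq_dvd_iff)
    show "nat (i mod (2 * int n)) \<in> {..<2 * n}"
      using n2 by (simp add: nat_less_iff)
  qed
  then show ?thesis using * by auto
qed

text \<open>Indices are integers without a fixed range, so a window of \<open>2 * n\<close> of them
  may start at any \<open>l\<close>. Statements about cyclic order thereby become plain
  inequalities.\<close>

lemma vtx_index_in:
  obtains j where "l \<le> j" "j < l + 2 * int n" "P i = P j"
proof
  show "P i = P (l + (i - l) mod (2 * int n))"
    unfolding vtx_eq_iff diff_diff_eq[symmetric] by (rule dvd_minus_mod)
qed (use n2 in auto)

lemma card_circle_points: "finite (circle_points n)" "card (circle_points n) = 2 * n"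
proof -
  have e: "circle_points n = P ` {0..<2 * int n}"
    unfolding circle_points_range using vtx_index_in[of 0] by (auto simp: image_iff) (metis atLeastLessThan_iff add_0)
  have "inj_on P {0..<2 * int n}"
    by (rule linorder_inj_onI) (use vtx_neq in force, auto)
  then show "finite (circle_points n)" "card (circle_points n) = 2 * n"
    unfolding e by (simp_all add: card_image)
qed

text \<open>All three half angle differences in \<open>ori_cis\<close> lie strictly between 0 and
  \<open>pi\<close>.\<close>

lemma ori_vtx_pos:
  assumes "i < j" "j < k" "k < i + 2 * int n"
  shows "ori (P i) (P j) (P k) > 0"
proof -
  have *: "sin ((pi * of_int y / n - pi * of_int x / n) / 2) > 0" if "x < y" "y < x + 2 * int n" for x y
  proof (rule sin_gt_zero)
    have r: "real_of_int x < real_of_int y" "real_of_int y < real_of_int x + 2 * real n"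
      using that by linarith+
    show "0 < (pi * of_int y / n - pi * of_int x / n) / 2"
      using r n2 by (simp add: field_simps)
    have "(pi * of_int y / n - pi * of_int x / n) / 2 = pi * ((of_int y - of_int x) / (2 * n))"
      by (simp add: diff_divide_distrib right_diff_distrib)
    also have "\<dots> < pi * 1" by (rule mult_strict_left_mono) (use r n2 in \<open>auto simp: field_simps\<close>)
    finally show "(pi * of_int y / n - pi * of_int x / n) / 2 < pi" by simp
  qed
  show ?thesis unfolding vtx_def ori_cis using assms by (intro mult_pos_pos *) auto
qed

lemma crossing_point:
  assumes "a < b" "b < c" "c < d" "d < a + 2 * int n"
  obtains z where "z \<in> open_segment (P a) (P c)" "z \<in> open_segment (P b) (P d)"
proof -
  define A B C D where "A = ori (P b) (P c) (P d)" and "B = ori (P a) (P c) (P d)"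
    and "C = ori (P a) (P b) (P d)" and "D = ori (P a) (P b) (P c)"
  have pos: "A > 0" "B > 0" "C > 0" "D > 0"
    unfolding A_def B_def C_def D_def using assms by (auto intro!: ori_vtx_pos)
  \<comment> \<open>Both sums are twice the area of the quadrilateral, cut along one diagonal or the
    other.\<close>
  have sum: "A + C = B + D" by (simp add: A_def B_def C_def D_def ori_def algebra_simps)
  \<comment> \<open>The affine dependency between four points of the plane; its coefficients alternate in sign.\<close>
  have bary: "A *\<^sub>R P a + C *\<^sub>R P c = B *\<^sub>R P b + D *\<^sub>R P d"
    unfolding A_def B_def C_def D_def ori_def complex_eq_iff by (simp add: algebra_simps)
  define z where "z = (A *\<^sub>R P a + C *\<^sub>R P c) /\<^sub>R (A + C)"
  have ne: "P a \<noteq> P c" "P b \<noteq> P d" using assms vtx_neq[of a c] vtx_neq[of b d] by auto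
  have "z \<in> open_segment (P a) (P c)"
    unfolding in_segment using pos ne
    by (intro conjI exI[of _ "C / (A + C)"])
       (auto simp: z_def scaleR_add_right field_simps simp flip: add_divide_distrib diff_divide_distrib)
  moreover have "z \<in> open_segment (P b) (P d)"
    unfolding in_segment using pos ne sum
    by (intro conjI exI[of _ "D / (B + D)"])
       (auto simp: z_def bary scaleR_add_right field_simps simp flip: add_divide_distrib diff_divide_distrib)
  ultimately show thesis by (rule that)
qed

lemma hulls_cross:
  assumes "a < b" "b < c" "c < d" "d < a + 2 * int n"
  shows "convex hull {P a, P c} \<inter> convex hull {P b, P d} \<noteq> {}"
proof -
  obtain z where "z \<in> open_segment (P a) (P c)" "z \<in> open_segment (P b) (P d)"
    using crossing_point[OF assms] by blast
  then have "z \<in> convex hull {P a, P c} \<inter> convex hull {P b, P d}"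
    by (simp add: segment_convex_hull[symmetric] open_segment_def)
  then show ?thesis by blast
qed

section \<open>Pairs of disjoint chords and the quadrilateral they span\<close>

lemma two_subset_vtx:
  assumes "e \<subseteq> circle_points n" "card e = 2"
  obtains a b where "e = {P a, P b}" "l \<le> a" "a < b" "b < l + 2 * int n"
proof -
  obtain x y where xy: "e = {x, y}" "x \<noteq> y" using assms(2) by (auto simp: card_2_iff)
  then have "x \<in> range P" "y \<in> range P" using assms(1) circle_points_range by auto
  then obtain i j where ij: "l \<le> i" "i < l + 2 * int n" "x = P i" "l \<le> j" "j < l + 2 * int n" "y = P j"
    using vtx_index_in[of l] by (metis rangeE)
  have "i \<noteq> j" using xy ij by auto
  then show thesis using that[of i j] that[of j i] xy ij by (cases "i < j") (auto simp: insert_commute)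
qed

lemma hulls_disjoint_imp_disjoint: "convex hull e \<inter> convex hull f = {} \<Longrightarrow> e \<inter> f = {}"
  using hull_subset[of e convex] hull_subset[of f convex] by blast

text \<open>Normal form for all later arguments about two edges. With the indices of
  \<open>f\<close> taken from the window that starts at an end of \<open>e\<close>, the only other
  arrangement is the interleaved one, in which the chords cross.\<close>

lemma disjoint_chords_order:
  assumes "e \<subseteq> circle_points n" "card e = 2" "f \<subseteq> circle_points n" "card f = 2"
    and disj: "convex hull e \<inter> convex hull f = {}"
  obtains a b c d where "e = {P a, P b}" "f = {P c, P d}" "a < b" "b < c" "c < d" "d < a + 2 * int n"
proof -
  obtain x y where e: "e = {P x, P y}" "x < y" "y < 0 + 2 * int n" "0 \<le> x" using two_subset_vtx[OF assms(1,2), of 0] by metis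
  obtain z w where f: "f = {P z, P w}" "x \<le> z" "z < w" "w < x + 2 * int n" using two_subset_vtx[OF assms(3,4), of x] by metis
  have ef: "e \<inter> f = {}" using disj by (rule hulls_disjoint_imp_disjoint)
  have ne: "z \<noteq> x" "z \<noteq> y" "w \<noteq> y" using ef e f by auto
  have nc: "\<not> (z < y \<and> y < w)"
    using hulls_cross[of x z y w] disj e f ne by auto
  consider "y < z" | "w < y" using ne nc f(3) by linarith
  then show thesis
  proof cases
    case 1
    then show ?thesis using that[of x y z w] e f by auto
  next
    case 2
    \<comment> \<open>Here \<open>f\<close> lies inside the arc from \<open>x\<close> to
      \<open>y\<close>, so the enumeration starts at \<open>y\<close> and runs on past a full
      turn.\<close>
    then show ?thesis using that[of y "x + 2 * int n" "z + 2 * int n" "w + 2 * int n"] e f ne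
      by (auto simp: insert_commute)
  qed
qed

text \<open>The two remaining vertices lie strictly to the left of the line through
  \<open>P i\<close> and \<open>P j\<close>, so this line cuts out a face; it has dimension 1
  because the two ends differ.\<close>

lemma side_edge_of:
  assumes "i < j" "j < k" "k < l" "l < i + 2 * int n"
  shows "convex hull {P i, P j} edge_of convex hull {P i, P j, P k, P l}"
proof -
  have pos: "ori (P i) (P j) (P k) > 0" "ori (P i) (P j) (P l) > 0"
    using assms by (auto intro!: ori_vtx_pos)
  have ne: "P i \<noteq> P j" using vtx_neq assms by simp
  have aff: "affine {z. ori (P i) (P j) z = 0}"
    unfolding affine_def by (auto simp: ori_affine)
  have "affine hull {P i, P j} \<subseteq> {z. ori (P i) (P j) z = 0}"
    by (rule hull_minimal) (use aff in auto)
  moreover have "convex hull ({P i, P j, P k, P l} - {P i, P j}) \<subseteq> {z. ori (P i) (P j) z > 0}"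
    by (rule hull_ori_pos) (use pos in auto)
  ultimately have "affine hull {P i, P j} \<inter> convex hull ({P i, P j, P k, P l} - {P i, P j}) = {}"
    by fastforce
  then have "convex hull {P i, P j} face_of convex hull {P i, P j, P k, P l}"
    by (intro face_of_convex_hulls) auto
  then show ?thesis by (simp add: edge_of_def aff_dim_convex_hull aff_dim_2 ne)
qed

text \<open>A face that contains an inner point of a segment contains its ends. Applied to the
  crossing point of the diagonals, this would put \<open>P j\<close> on the other diagonal.\<close>

lemma diagonal_not_edge_of:
  assumes "i < j" "j < k" "k < l" "l < i + 2 * int n"
  shows "\<not> convex hull {P i, P k} edge_of convex hull {P i, P j, P k, P l}"
proof
  assume "convex hull {P i, P k} edge_of convex hull {P i, P j, P k, P l}"
  then have F: "convex hull {P i, P k} face_of convex hull {P i, P j, P k, P l}" by (simp add: edge_of_def)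
  obtain z where z: "z \<in> open_segment (P i) (P k)" "z \<in> open_segment (P j) (P l)"
    using crossing_point[OF assms] by blast
  have "z \<in> convex hull {P i, P k}" using z(1) by (simp add: segment_convex_hull[symmetric] open_segment_def)
  then have "P j \<in> convex hull {P i, P k}"
    by (intro face_ofD[OF F z(2), THEN conjunct1]) (auto intro: hull_inc)
  moreover have "convex hull {P k, P i} \<inter> convex hull {P j} = {}"
    by (rule hulls_disjoint_ori)
       (use ori_vtx_pos[of k "i + 2 * int n" "j + 2 * int n"] assms in auto)
  ultimately show False by (simp add: insert_commute)
qed

text \<open>Of the six pairs among the four ends only the two diagonals fail. Cyclic shifts of the
  indices make every side an instance of \<open>side_edge_of\<close>.\<close>

lemma quadrilateral_sides_eq:
  assumes "a < b" "b < c" "c < d" "d < a + 2 * int n"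
  shows "quadrilateral_sides {P a, P b} {P c, P d} = {{P a, P b}, {P b, P c}, {P c, P d}, {P d, P a}}"
proof -
  have ne: "P a \<noteq> P b" "P b \<noteq> P c" "P c \<noteq> P d" "P a \<noteq> P d" "P a \<noteq> P c" "P b \<noteq> P d"
    using assms vtx_neq[of a b] vtx_neq[of b c] vtx_neq[of c d] vtx_neq[of a d] vtx_neq[of a c] vtx_neq[of b d]
    by auto
  let ?S = "{P a, P b, P c, P d}"
  have S: "{P b, P c, P d, P a} = ?S" "{P c, P d, P a, P b} = ?S" "{P d, P a, P b, P c} = ?S"
    "{P a, P b} \<union> {P c, P d} = ?S" by auto
  have sides: "convex hull {P a, P b} edge_of convex hull ?S" "convex hull {P b, P c} edge_of convex hull ?S"
    "convex hull {P c, P d} edge_of convex hull ?S" "convex hull {P d, P a} edge_of convex hull ?S"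
    using side_edge_of[of a b c d] side_edge_of[of b c d "a + 2 * int n"]
      side_edge_of[of c d "a + 2 * int n" "b + 2 * int n"]
      side_edge_of[of d "a + 2 * int n" "b + 2 * int n" "c + 2 * int n"] assms
    by (auto simp: S)
  have diags: "\<not> convex hull {P a, P c} edge_of convex hull ?S" "\<not> convex hull {P b, P d} edge_of convex hull ?S"
    using diagonal_not_edge_of[of a b c d] diagonal_not_edge_of[of b c d "a + 2 * int n"] assms
    by (auto simp: S)
  have six: "g = {P a, P b} \<or> g = {P b, P c} \<or> g = {P c, P d} \<or> g = {P d, P a} \<or> g = {P a, P c} \<or> g = {P b, P d}"
    if gS: "g \<subseteq> ?S" "card g = 2" for g
  proof -
    obtain x y where g: "g = {x, y}" "x \<noteq> y" using gS(2) by (auto simp: card_2_iff)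
    then have "x \<in> ?S" "y \<in> ?S" using gS(1) by auto
    then show ?thesis using g(2) unfolding g(1)
      by (elim insertE emptyE) (simp_all only: doubleton_eq_iff simp_thms)
  qed
  show ?thesis unfolding quadrilateral_sides_def S(4)
  proof (intro equalityI subsetI)
    fix g assume "g \<in> {g. g \<subseteq> ?S \<and> card g = 2 \<and> convex hull g edge_of convex hull ?S}"
    then have "g \<subseteq> ?S" "card g = 2" "convex hull g edge_of convex hull ?S" by simp_all
    then show "g \<in> {{P a, P b}, {P b, P c}, {P c, P d}, {P d, P a}}" using six[of g] diags unfolding insert_iff by metis
  next
    fix g assume "g \<in> {{P a, P b}, {P b, P c}, {P c, P d}, {P d, P a}}"
    then show "g \<in> {g. g \<subseteq> ?S \<and> card g = 2 \<and> convex hull g edge_of convex hull ?S}"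
      using sides ne by (elim insertE emptyE) simp_all
  qed
qed

section \<open>Arcs shorter than a half circle and the shadows of chords\<close>

lemma vtx_in_image:
  "l \<le> x \<and> x \<le> u \<or> l \<le> x + 2 * int n \<and> x + 2 * int n \<le> u \<Longrightarrow> P x \<in> P ` {l..u}"
  by (metis atLeastAtMost_iff imageI vtx_periodic)

lemma zero_notin_hull_half_circle:
  assumes "S \<subseteq> P ` {l..u}" "u < l + int n"
  shows "0 \<notin> convex hull S"
proof -
  \<comment> \<open>The angle of the midpoint of the arc; the whole arc lies within less than
    \<open>pi / 2\<close> of it, hence in an open half-plane bounded by a line through the
    center.\<close>
  define m where "m = pi * (of_int l + of_int u) / (2 * real n)"
  define H where "H = {z. inner (cis m) z > 0}"
  have "x \<in> H" if xS: "x \<in> S" for x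
  proof -
    obtain i where i: "x = P i" "l \<le> i" "i \<le> u" using assms(1) xS by auto
    have r: "real_of_int l \<le> real_of_int i" "real_of_int i \<le> real_of_int u" "real_of_int u < real_of_int l + real n"
      using i assms(2) by linarith+
    have "inner (cis m) x = cos (pi * of_int i / n - m)"
      by (simp add: i vtx_def inner_complex_def cos_diff algebra_simps)
    moreover have "pi * of_int i / n - m = pi * ((2 * of_int i - of_int l - of_int u) / (2 * n))"
      using n2 by (simp add: m_def field_simps)
    moreover have "cos (pi * ((2 * of_int i - of_int l - of_int u) / (2 * n))) > 0"
    proof (rule cos_gt_zero_pi)
      have "pi * (-1/2) < pi * ((2 * of_int i - of_int l - of_int u) / (2 * n))"
        by (rule mult_strict_left_mono) (use r n2 in \<open>auto simp: field_simps\<close>)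
      then show "- (pi/2) < pi * ((2 * of_int i - of_int l - of_int u) / (2 * n))" by simp
      have "pi * ((2 * of_int i - of_int l - of_int u) / (2 * n)) < pi * (1/2)"
        by (rule mult_strict_left_mono) (use r n2 in \<open>auto simp: field_simps\<close>)
      then show "pi * ((2 * of_int i - of_int l - of_int u) / (2 * n)) < pi/2" by simp
    qed
    ultimately show ?thesis by (simp add: H_def)
  qed
  moreover have "convex H" unfolding H_def by (rule convex_halfspace_gt)
  ultimately have "convex hull S \<subseteq> H" by (simp add: hull_minimal subsetI)
  then show ?thesis by (auto simp: H_def)
qed

text \<open>Stated through rays from the center, since the parameter \<open>s\<close> later serves
  to compare the distances at which two edges meet the same ray.\<close>

definition shadow :: "complex set \<Rightarrow> complex set" where
  "shadow e = {p \<in> circle_points n. \<exists>s>0. s *\<^sub>R p \<in> convex hull e}"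

text \<open>The cross product of two vertices that are \<open>k\<close> steps apart (see
  \<open>Im_cnj_vtx\<close>); its sign tells which half of the circle the second one lies in, seen
  from the first.\<close>

definition sn :: "int \<Rightarrow> real" where "sn k = sin (pi * of_int k / n)"

lemma sn_pos: "0 < k \<Longrightarrow> k < int n \<Longrightarrow> sn k > 0"
proof -
  assume k: "0 < k" "k < int n"
  then have r: "0 < real_of_int k" "real_of_int k < n" by linarith+
  have "pi * (of_int k / n) < pi * 1" by (rule mult_strict_left_mono) (use r in \<open>auto simp: field_simps\<close>)
  then show ?thesis unfolding sn_def using r by (intro sin_gt_zero) auto
qed

lemma sn_0 [simp]: "sn 0 = 0" by (simp add: sn_def)

lemma sn_minus: "sn (- k) = - sn k" by (simp add: sn_def)

lemma sn_antipode: "sn (k + int n) = - sn k"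
proof -
  have "pi * of_int (k + int n) / n = pi * of_int k / n + pi" using n2 by (simp add: field_simps)
  then show ?thesis by (simp add: sn_def)
qed

lemma sn_neg: "int n < k \<Longrightarrow> k < 2 * int n \<Longrightarrow> sn k < 0"
  using sn_pos[of "k - int n"] sn_antipode[of "k - int n"] by simp

lemma Im_cnj_vtx: "Im (cnj (P a) * P b) = sn (b - a)"
  by (simp add: vtx_def sn_def diff_divide_distrib right_diff_distrib sin_diff)

text \<open>A sine identity for three directions. For \<open>v\<close> between \<open>a\<close> and
  \<open>b\<close> on an arc shorter than a half circle all coefficients are nonnegative, so the ray
  through \<open>P v\<close> meets the chord.\<close>

lemma vtx_combination: "sn (b - v) *\<^sub>R P a + sn (v - a) *\<^sub>R P b = sn (b - a) *\<^sub>R P v"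
proof -
  have *: "sin (z - y) *\<^sub>R cis x + sin (y - x) *\<^sub>R cis z = sin (z - x) *\<^sub>R cis y" for x y z :: real
  proof -
    define p q where "p = y - x" and "q = z - y"
    have d: "y = x + p" "z = x + p + q" by (simp_all add: p_def q_def)
    have "sin q * sin x + sin p * sin (x + p + q) = sin (p + q) * sin (x + p)"
      "sin q * cos x + sin p * cos (x + p + q) = sin (p + q) * cos (x + p)"
      unfolding sin_add cos_add using sin_cos_squared_add3[of p] by algebra+
    then show ?thesis by (simp add: d complex_eq_iff)
  qed
  show ?thesis
    using *[of "pi * of_int b / n" "pi * of_int v / n" "pi * of_int a / n"]
    by (simp add: vtx_def sn_def diff_divide_distrib right_diff_distrib)
qed

lemma shadow_eq:
  assumes "a < b" "b < a + int n"
  shows "shadow {P a, P b} = P ` {a..b}"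
proof
  show "P ` {a..b} \<subseteq> shadow {P a, P b}"
  proof clarify
    fix v assume v: "v \<in> {a..b}"
    let ?x = "sn (b - v)" and ?y = "sn (v - a)"
    have nn: "?x \<ge> 0" "?y \<ge> 0"
      using v assms sn_pos[of "b - v"] sn_pos[of "v - a"] by (cases "v = b"; cases "v = a"; force)+
    have "?x > 0 \<or> ?y > 0"
      using v assms sn_pos[of "b - v"] sn_pos[of "v - a"] by (cases "v = b"; force)
    then have s: "?x + ?y > 0" using nn by linarith
    have "(sn (b - a) / (?x + ?y)) *\<^sub>R P v = (sn (b - v) *\<^sub>R P a + sn (v - a) *\<^sub>R P b) /\<^sub>R (?x + ?y)"
      unfolding vtx_combination by (simp add: divide_inverse mult.commute)
    also have "\<dots> \<in> convex hull {P a, P b}"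
      unfolding convex_hull_2 using nn s
      by - (rule CollectI, rule exI[of _ "?x / (?x + ?y)"], rule exI[of _ "?y / (?x + ?y)"],
          simp add: scaleR_add_right divide_inverse mult.commute flip: distrib_right)
    finally have "(sn (b - a) / (?x + ?y)) *\<^sub>R P v \<in> convex hull {P a, P b}" .
    moreover have "sn (b - a) / (?x + ?y) > 0" using s sn_pos assms by simp
    ultimately show "P v \<in> shadow {P a, P b}" unfolding shadow_def circle_points_range by blast
  qed
  show "shadow {P a, P b} \<subseteq> P ` {a..b}"
  proof
    fix p assume "p \<in> shadow {P a, P b}"
    then obtain s where p: "p \<in> range P" and s: "s > 0" "s *\<^sub>R p \<in> convex hull {P a, P b}"
      unfolding shadow_def circle_points_range by blast
    obtain v where v: "p = P v" "a \<le> v" "v < a + 2 * int n" using p vtx_index_in[of a] by (metis rangeE)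
    obtain x y where xy: "x \<ge> 0" "y \<ge> 0" "s *\<^sub>R P v = x *\<^sub>R P a + y *\<^sub>R P b"
      using s(2) unfolding convex_hull_2 v(1) by auto
    have pos: "sn (b - a) > 0" using sn_pos assms by simp
    \<comment> \<open>The cross product with \<open>P a\<close> removes the term of
      \<open>P a\<close>, so \<open>sn (v - a)\<close> inherits its sign from \<open>y\<close>. The
      product with \<open>P b\<close> below does the same for \<open>sn (b - v)\<close> and
      \<open>x\<close>.\<close>
    have "s * Im (cnj (P a) * P v) = x * Im (cnj (P a) * P a) + y * Im (cnj (P a) * P b)"
      using arg_cong[OF xy(3), of "\<lambda>z. Im (cnj (P a) * z)"] by (simp add: algebra_simps)
    then have "s * sn (v - a) = y * sn (b - a)"
      unfolding Im_cnj_vtx by simp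
    then have "sn (v - a) \<ge> 0" using xy(2) pos s(1) by (metis mult_nonneg_nonneg less_imp_le zero_le_mult_iff not_less)
    then have v1: "v \<le> a + int n" using sn_neg[of "v - a"] v by linarith
    have "s * Im (cnj (P v) * P b) = x * Im (cnj (P a) * P b) + y * Im (cnj (P b) * P b)"
      using arg_cong[OF xy(3), of "\<lambda>z. Im (cnj z * P b)"] by (simp add: algebra_simps)
    then have "s * sn (b - v) = x * sn (b - a)"
      unfolding Im_cnj_vtx by simp
    then have "sn (b - v) \<ge> 0" using xy(1) pos s(1) by (metis mult_nonneg_nonneg less_imp_le zero_le_mult_iff not_less)
    \<comment> \<open>If \<open>v\<close> exceeded \<open>b\<close>, the bound \<open>v1\<close>
      would give \<open>0 < v - b < n\<close>, and \<open>sn (b - v)\<close> would be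
      negative.\<close>
    then have "v \<le> b" using sn_pos[of "v - b"] sn_minus[of "v - b"] v1 assms by force
    then show "p \<in> P ` {a..b}" using v by auto
  qed
qed

section \<open>Matchings and centered flips\<close>

lemma matchingD:
  assumes "M \<in> matchings n" "e \<in> M"
  shows "e \<subseteq> circle_points n" "card e = 2"
  using assms(1)[unfolded matchings_def mem_Collect_eq, THEN conjunct1, THEN bspec, OF assms(2)]
  by simp_all

lemma matching_hulls_disjoint:
  assumes "M \<in> matchings n" "e \<in> M" "f \<in> M" "e \<noteq> f"
  shows "convex hull e \<inter> convex hull f = {}"
  using assms(1)[unfolded matchings_def mem_Collect_eq, THEN conjunct2, THEN conjunct2,
      THEN bspec, OF assms(2), THEN bspec, OF assms(3)] assms(4)
  by simp

lemma matching_disjoint: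
  "M \<in> matchings n \<Longrightarrow> e \<in> M \<Longrightarrow> f \<in> M \<Longrightarrow> e \<noteq> f \<Longrightarrow> e \<inter> f = {}"
  by (rule hulls_disjoint_imp_disjoint, rule matching_hulls_disjoint)

lemma matching_covers:
  assumes "M \<in> matchings n" "p \<in> circle_points n"
  obtains e where "e \<in> M" "p \<in> e"
  using assms(1)[unfolded matchings_def mem_Collect_eq, THEN conjunct2, THEN conjunct1,
      THEN bspec, OF assms(2)] that
  by (elim ex1E conjE)

lemma matchings_subset: "matchings n \<subseteq> Pow (Pow (circle_points n))"
  by (intro subsetI PowI) (erule (1) matchingD(1)[THEN subsetD])

lemma finite_matchings: "finite (matchings n)"
  by (rule finite_subset[OF matchings_subset]) (simp add: card_circle_points(1))

lemma finite_matching: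
  assumes "M \<in> matchings n"
  shows "finite M"
proof (rule finite_subset)
  show "M \<subseteq> Pow (circle_points n)" using subsetD[OF matchings_subset assms] by (rule PowD)
qed (simp add: card_circle_points(1))

lemma matching_card_Union:
  assumes "M \<in> matchings n" "C \<subseteq> M"
  shows "2 * card C = card (\<Union>C)"
proof (rule card_partition)
  show "finite C" using assms finite_matching finite_subset by blast
  have "\<Union>C \<subseteq> circle_points n" using assms matchingD(1)[OF assms(1)] by (auto simp: subset_iff)
  then show "finite (\<Union>C)" using card_circle_points(1) finite_subset by blast
  show "card c = 2" if "c \<in> C" for c using that assms matchingD(2) by auto
  show "c \<inter> d = {}" if "c \<in> C" "d \<in> C" "c \<noteq> d" for c d
    using that assms by (intro matching_disjoint[OF assms(1)]) auto
qed

lemma card_matching: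
  assumes "M \<in> matchings n"
  shows "card M = n"
proof -
  have "\<Union>M = circle_points n" 
  proof
    show "\<Union>M \<subseteq> circle_points n" using matchingD(1)[OF assms] by (auto simp: subset_iff)
    show "circle_points n \<subseteq> \<Union>M" using matching_covers[OF assms] by (metis UnionI subsetI)
  qed
  then show ?thesis using matching_card_Union[OF assms order_refl] card_circle_points(2) by simp
qed

text \<open>An edge with one end in the open arc and the other beyond it would interleave with
  \<open>{P a, P b}\<close> and cross it.\<close>

lemma matching_edge_side:
  assumes M: "M \<in> matchings n" and "{P a, P b} \<in> M" "a < b" "b < a + 2 * int n"
    and f: "f \<in> M" "f \<noteq> {P a, P b}"
  shows "f \<subseteq> P ` {a<..<b} \<or> f \<inter> P ` {a<..<b} = {}"
proof (rule disjCI)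
  assume "f \<inter> P ` {a<..<b} \<noteq> {}"
  then obtain x where x: "P x \<in> f" "a < x" "x < b" by auto
  have disj: "convex hull {P a, P b} \<inter> convex hull f = {}" "{P a, P b} \<inter> f = {}"
    using matching_hulls_disjoint[OF M] matching_disjoint[OF M] assms by auto
  show "f \<subseteq> P ` {a<..<b}"
  proof
    fix q assume q: "q \<in> f"
    then have "q \<in> range P" using matchingD[OF M f(1)] circle_points_range by auto
    then obtain y where y: "q = P y" "a \<le> y" "y < a + 2 * int n" using vtx_index_in[of a] by (metis rangeE)
    have "y \<noteq> a" "y \<noteq> b" using disj(2) q y by auto
    moreover have "\<not> b < y"
    proof
      assume "b < y"
      then have "convex hull {P a, P b} \<inter> convex hull {P x, P y} \<noteq> {}"
        using hulls_cross[of a x b y] x y by auto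
      moreover have "convex hull {P x, P y} \<subseteq> convex hull f" by (rule hull_mono) (use x q y in auto)
      ultimately show False using disj(1) by blast
    qed
    ultimately show "q \<in> P ` {a<..<b}" using y by auto
  qed
qed

text \<open>The \<open>n - 1\<close> vertices strictly on one side of the edge are matched among
  themselves, so their number is even.\<close>

lemma diametral_edge_odd:
  assumes M: "M \<in> matchings n" and e: "{P a, P (a + int n)} \<in> M"
  shows "odd n"
proof -
  let ?X = "P ` {a<..<a + int n}"
  let ?C = "{f \<in> M. f \<subseteq> ?X}"
  have inj: "inj_on P {a<..<a + int n}"
    by (rule linorder_inj_onI) (use vtx_neq in force, auto)
  have notin: "\<not> x \<in> {P a, P (a + int n)}" if "x \<in> ?X" for x
    using that vtx_neq[of a] vtx_neq[of _ "a + int n"] by fastforce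
  have "\<Union>?C = ?X"
  proof
    show "?X \<subseteq> \<Union>?C"
    proof
      fix x assume x: "x \<in> ?X"
      then obtain f where f: "f \<in> M" "x \<in> f" using matching_covers[OF M] circle_points_range by (metis image_iff rangeI)
      have "f \<noteq> {P a, P (a + int n)}" using f notin[OF x] by blast
      then have "f \<subseteq> ?X" using matching_edge_side[OF M e _ _ f(1)] x f(2) n2 by auto
      then show "x \<in> \<Union>?C" using f by blast
    qed
  qed auto
  then have "2 * card ?C = card ?X" using matching_card_Union[OF M, of ?C] by auto
  also have "\<dots> = n - 1" using inj n2 by (simp add: card_image nat_diff_distrib)
  finally have "n = 2 * card ?C + 1" using n2 by linarith
  then obtain k where "n = 2 * k + 1" ..
  then show ?thesis by simp
qed

section \<open>Flips in explicit form and the neighbours of a matching\<close>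

lemma zero_in_hull_antipodal: "P a \<in> S \<Longrightarrow> P (a + int n) \<in> S \<Longrightarrow> 0 \<in> convex hull S"
proof -
  assume S: "P a \<in> S" "P (a + int n) \<in> S"
  have "(1/2) *\<^sub>R P a + (1/2) *\<^sub>R P (a + int n) \<in> convex hull S"
    by (rule convexD[OF convex_convex_hull]) (use S in \<open>auto intro: hull_inc\<close>)
  then show ?thesis by (simp add: vtx_antipode)
qed

text \<open>The two new edges are foreign to \<open>M\<close> because each shares exactly one end
  with \<open>{P a, P b}\<close>. This makes it possible to undo a flip and to recover the flipped
  pair.\<close>

lemma flip_eq:
  assumes M: "M \<in> matchings n" and "{P a, P b} \<in> M" "{P c, P d} \<in> M"
    and "a < b" "b < c" "c < d" "d < a + 2 * int n"
  shows "flip M {P a, P b} {P c, P d} = (M - {{P a, P b}, {P c, P d}}) \<union> {{P b, P c}, {P d, P a}}"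
    "{P b, P c} \<notin> M" "{P d, P a} \<notin> M"
proof -
  have ne: "P a \<noteq> P b" "P b \<noteq> P c" "P c \<noteq> P d" "P a \<noteq> P d" "P a \<noteq> P c" "P b \<noteq> P d"
    using assms vtx_neq[of a b] vtx_neq[of b c] vtx_neq[of c d] vtx_neq[of a d] vtx_neq[of a c] vtx_neq[of b d]
    by auto
  show "flip M {P a, P b} {P c, P d} = (M - {{P a, P b}, {P c, P d}}) \<union> {{P b, P c}, {P d, P a}}"
    unfolding flip_def quadrilateral_sides_eq[OF assms(4-7)] using ne by (auto simp: doubleton_eq_iff)
  show "{P b, P c} \<notin> M"
    using matching_disjoint[OF M assms(2), of "{P b, P c}"] ne by (auto simp: doubleton_eq_iff)
  show "{P d, P a} \<notin> M"
    using matching_disjoint[OF M assms(2), of "{P d, P a}"] ne by (auto simp: doubleton_eq_iff)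
qed

definition centered_pair :: "complex set set \<Rightarrow> complex set \<Rightarrow> complex set \<Rightarrow> bool" where
  "centered_pair M e f \<longleftrightarrow> empty_quadrilateral M e f \<and> 0 \<in> convex hull (e \<union> f)"

lemma centered_pair_commute: "centered_pair M e f \<Longrightarrow> centered_pair M f e"
  unfolding centered_pair_def empty_quadrilateral_def by (metis Un_commute insert_commute)

lemma flip_commute: "flip M e f = flip M f e"
  by (simp only: flip_def quadrilateral_sides_def Un_commute insert_commute)

lemma centered_pairD:
  assumes "centered_pair M e f"
  shows "e \<in> M" "f \<in> M" "e \<noteq> f" "0 \<in> convex hull (e \<union> f)"
    "\<And>g. g \<in> M \<Longrightarrow> convex hull g \<inter> convex hull (e \<union> f) \<noteq> {} \<Longrightarrow> g = e \<or> g = f"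
  using assms unfolding centered_pair_def empty_quadrilateral_def by (metis Diff_iff empty_iff insert_iff)+

lemma centered_pair_vtx:
  assumes M: "M \<in> matchings n" and "centered_pair M e f"
  obtains a b c d where "e = {P a, P b}" "f = {P c, P d}" "a < b" "b < c" "c < d" "d < a + 2 * int n"
proof -
  note ef = centered_pairD(1-3)[OF assms(2)]
  show thesis
    by (rule disjoint_chords_order[OF matchingD[OF M ef(1)] matchingD[OF M ef(2)] matching_hulls_disjoint[OF M ef]])
       (rule that)
qed

text \<open>The two new edges span the same quadrilateral, whose other sides are the removed edges.
  Symmetry is needed because \<open>H_edges\<close> consists of unordered pairs.\<close>

lemma centered_flip_sym:
  assumes M: "M \<in> matchings n" and M': "M' \<in> matchings n" and "centered_flip M M'"
  shows "centered_flip M' M"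
proof -
  obtain e f where ef: "centered_pair M e f" "M' = flip M e f"
    using assms(3) unfolding centered_flip_def centered_pair_def by blast
  obtain a b c d where o: "e = {P a, P b}" "f = {P c, P d}" "a < b" "b < c" "c < d" "d < a + 2 * int n"
    by (rule centered_pair_vtx[OF M ef(1)])
  note D = centered_pairD[OF ef(1)]
  note F = flip_eq[OF M D(1)[unfolded o] D(2)[unfolded o] o(3-6)]
  have M'eq: "M' = (M - {e, f}) \<union> {{P b, P c}, {P d, P a}}" using ef(2) F(1) o(1,2) by simp
  \<comment> \<open>The index \<open>a\<close> is raised by a full turn so that the ends appear in
    the increasing order \<open>b\<close>, \<open>c\<close>, \<open>d\<close>,
    \<open>a + 2 * int n\<close>.\<close>
  have "flip M' {P b, P c} {P d, P (a + 2 * int n)}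
      = (M' - {{P b, P c}, {P d, P (a + 2 * int n)}}) \<union> {{P c, P d}, {P (a + 2 * int n), P b}}"
    by (rule flip_eq[OF M']) (use o M'eq in auto)
  also have "\<dots> = M"
    unfolding M'eq vtx_periodic o(1)[symmetric] o(2)[symmetric]
    using F(2,3) D(1,2) o(1) by (auto simp: insert_commute)
  finally have "M = flip M' {P b, P c} {P d, P a}" by simp
  moreover have u: "{P b, P c} \<union> {P d, P a} = e \<union> f" using o by auto
  have "empty_quadrilateral M' {P b, P c} {P d, P a}"
    unfolding empty_quadrilateral_def u
  proof (intro conjI ballI)
    show "{P b, P c} \<noteq> {P d, P a}"
      using vtx_neq[of b d] vtx_neq[of a b] o by (auto simp: doubleton_eq_iff)
    fix g assume "g \<in> M' - {{P b, P c}, {P d, P a}}"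
    then have "g \<in> M - {e, f}" using M'eq by blast
    then show "convex hull g \<inter> convex hull (e \<union> f) = {}" using D(5)[of g] by auto
  qed (auto simp: M'eq)
  ultimately show ?thesis unfolding centered_flip_def using D(4) u by metis
qed

definition neighbours :: "complex set set \<Rightarrow> complex set set set" where
  "neighbours M = {M' \<in> matchings n. \<exists>e f. centered_pair M e f \<and> M' = flip M e f}"

lemma finite_neighbours: "finite (neighbours M)"
  by (rule finite_subset[OF _ finite_matchings]) (unfold neighbours_def, rule Collect_subset)

text \<open>By symmetry of flips \<open>M\<close> can be taken as the first member of each incident
  edge, and \<open>M'\<close> can be recovered from \<open>{M, M'}\<close>.\<close>

lemma vertex_degree_eq:
  assumes M: "M \<in> matchings n"
  shows "vertex_degree (H_edges n) M = card (neighbours M)"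
proof -
  have nb: "M' \<in> neighbours M \<longleftrightarrow> M' \<in> matchings n \<and> centered_flip M M'" for M'
    unfolding neighbours_def centered_flip_def centered_pair_def mem_Collect_eq by (simp only: conj_assoc)
  have "{x \<in> H_edges n. M \<in> x} = (\<lambda>M'. {M, M'}) ` neighbours M"
  proof (intro set_eqI iffI)
    fix x assume "x \<in> {x \<in> H_edges n. M \<in> x}"
    then obtain M1 M2 where x: "x = {M1, M2}" "M1 \<in> matchings n" "M2 \<in> matchings n" "centered_flip M1 M2" "M \<in> x"
      by (auto simp: H_edges_def)
    then consider "M = M1" | "M = M2" by blast
    then show "x \<in> (\<lambda>M'. {M, M'}) ` neighbours M"
    proof cases
      case 1
      then have "M2 \<in> neighbours M" using x nb by simp
      then show ?thesis using x 1 by auto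
    next
      case 2
      then have "M1 \<in> neighbours M" using x nb centered_flip_sym[of M1 M2] by simp
      then show ?thesis using x 2 by (auto simp: insert_commute)
    qed
  next
    fix x assume "x \<in> (\<lambda>M'. {M, M'}) ` neighbours M"
    then obtain M' where "x = {M, M'}" "M' \<in> matchings n" "centered_flip M M'" using nb by auto
    then show "x \<in> {x \<in> H_edges n. M \<in> x}" using M by (auto simp: H_edges_def)
  qed
  moreover have "inj_on (\<lambda>M'. {M, M'}) (neighbours M)"
    by (rule inj_onI) (auto simp: doubleton_eq_iff)
  ultimately show ?thesis by (simp add: vertex_degree_def card_image)
qed

text \<open>The edge \<open>d\<close> meets every centered quadrilateral in the center, so emptiness
  makes it one of the two flipped edges. Only the choice of the other one remains.\<close>

lemma diametral_neighbours:
  assumes M: "M \<in> matchings n" and d: "d \<in> M" "0 \<in> convex hull d"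
  shows "card (neighbours M) \<le> n - 1"
proof -
  have "neighbours M \<subseteq> flip M d ` (M - {d})"
  proof
    fix M' assume "M' \<in> neighbours M"
    then have "\<exists>e f. centered_pair M e f \<and> M' = flip M e f" by (simp only: neighbours_def mem_Collect_eq)
    then obtain e f where ef: "centered_pair M e f" "M' = flip M e f" by (elim exE conjE)
    note D = centered_pairD[OF ef(1)]
    have "d = e \<or> d = f" using D(4) D(5)[OF d(1)] d(2) by blast
    then show "M' \<in> flip M d ` (M - {d})" using D(1-3) ef(2) flip_commute[of M e f] by auto
  qed
  then have "card (neighbours M) \<le> card (M - {d})"
    using finite_matching[OF M] by (meson card_image_le card_mono finite_Diff finite_imageI order_trans)
  then show ?thesis using card_matching[OF M] d(1) finite_matching[OF M] by simp
qed

section \<open>Upper bound on the degree\<close>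

text \<open>If one of the four arcs between consecutive ends exceeded a half circle, all ends would
  lie in the shorter complementary arc, away from the center. The arcs of \<open>e\<close> and
  \<open>f\<close> are strictly shorter than a half circle because neither edge contains the center;
  the two gaps may equal it.\<close>

lemma centered_pair_gaps:
  assumes M: "M \<in> matchings n" and nd: "\<And>g. g \<in> M \<Longrightarrow> 0 \<notin> convex hull g"
    and ef: "centered_pair M e f"
  obtains a b c d where "e = {P a, P b}" "f = {P c, P d}" "a < b" "b < c" "c < d" "d < a + 2 * int n"
    "b < a + int n" "c \<le> b + int n" "d < c + int n" "a + int n \<le> d"
proof -
  obtain a b c d where o: "e = {P a, P b}" "f = {P c, P d}" "a < b" "b < c" "c < d" "d < a + 2 * int n"
    by (rule centered_pair_vtx[OF M ef])
  note D = centered_pairD[OF ef]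
  have hc: False if "u < l + int n" "P a \<in> P ` {l..u}" "P b \<in> P ` {l..u}" "P c \<in> P ` {l..u}" "P d \<in> P ` {l..u}" for l u
    using zero_notin_hull_half_circle[of "e \<union> f" l u] that D(4) o(1,2) by simp
  have diam: "b \<noteq> a + int n" "d \<noteq> c + int n"
    using zero_in_hull_antipodal[of a e] zero_in_hull_antipodal[of c f] nd[OF D(1)] nd[OF D(2)] o by auto
  have "\<not> a + int n < b"
    using hc[of "a + 2 * int n" b, OF _ vtx_in_image vtx_in_image vtx_in_image vtx_in_image] o by force
  moreover have "\<not> b + int n < c"
    using hc[of "b + 2 * int n" c, OF _ vtx_in_image vtx_in_image vtx_in_image vtx_in_image] o by force
  moreover have "\<not> c + int n < d"
    using hc[of "c + 2 * int n" d, OF _ vtx_in_image vtx_in_image vtx_in_image vtx_in_image] o by force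
  moreover have "\<not> d < a + int n"
    using hc[of d a, OF _ vtx_in_image vtx_in_image vtx_in_image vtx_in_image] o by force
  ultimately show thesis using that[OF o] diam by linarith
qed

lemma centered_pair_shadows_disjoint:
  assumes M: "M \<in> matchings n" and nd: "\<And>g. g \<in> M \<Longrightarrow> 0 \<notin> convex hull g"
    and ef: "centered_pair M e f"
  shows "shadow e \<inter> shadow f = {}"
proof -
  obtain a b c d where o: "e = {P a, P b}" "f = {P c, P d}" "a < b" "b < c" "c < d" "d < a + 2 * int n"
    "b < a + int n" "c \<le> b + int n" "d < c + int n" "a + int n \<le> d"
    by (rule centered_pair_gaps[OF assms])
  have "P x \<noteq> P y" if "x \<in> {a..b}" "y \<in> {c..d}" for x y
    using vtx_neq[of x y] that o by auto
  then show ?thesis using shadow_eq[of a b] shadow_eq[of c d] o by auto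
qed

lemma centered_pair_shadow_unique_aux:
  assumes M: "M \<in> matchings n" and nd: "\<And>g. g \<in> M \<Longrightarrow> 0 \<notin> convex hull g"
    and ef: "centered_pair M e f" and ef': "centered_pair M e' f'"
    and s: "p \<in> shadow e" "p \<in> shadow e'" "s *\<^sub>R p \<in> convex hull e" "s' *\<^sub>R p \<in> convex hull e'" "0 < s" "s \<le> s'"
  shows "e = e'"
proof -
  \<comment> \<open>The edge nearer to the center meets the quadrilateral of the other one, which contains the center.\<close>
  have "s' *\<^sub>R p \<in> convex hull (e' \<union> f')" using s(4) hull_mono[of e' "e' \<union> f'" convex] by blast
  then have "(1 - s / s') *\<^sub>R 0 + (s / s') *\<^sub>R (s' *\<^sub>R p) \<in> convex hull (e' \<union> f')"
    using centered_pairD(4)[OF ef'] s(5,6) by (intro convexD[OF convex_convex_hull]) auto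
  then have "s *\<^sub>R p \<in> convex hull (e' \<union> f')" using s(5,6) by simp
  then have "e = e' \<or> e = f'"
    using centered_pairD(5)[OF ef' centered_pairD(1)[OF ef]] s(3) by blast
  \<comment> \<open>The case \<open>e = f'\<close> is excluded, as \<open>p\<close> would lie in the
    shadows of both members of a centered pair.\<close>
  then show ?thesis using centered_pair_shadows_disjoint[OF M nd ef'] s(1,2) by blast
qed

text \<open>The edge that meets the ray at the smaller distance takes the first role in the
  auxiliary lemma. The counting rests on this: edges that take part in centered flips have pairwise
  disjoint shadows.\<close>

lemma centered_pair_shadow_unique:
  assumes M: "M \<in> matchings n" and nd: "\<And>g. g \<in> M \<Longrightarrow> 0 \<notin> convex hull g"
    and ef: "centered_pair M e f" and ef': "centered_pair M e' f'"
    and p: "p \<in> shadow e" "p \<in> shadow e'"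
  shows "e = e'"
proof -
  obtain s s' where "0 < s" "s *\<^sub>R p \<in> convex hull e" "0 < s'" "s' *\<^sub>R p \<in> convex hull e'"
    using p unfolding shadow_def by blast
  then show ?thesis
    using centered_pair_shadow_unique_aux[OF M nd ef ef' p, of s s']
      centered_pair_shadow_unique_aux[OF M nd ef' ef p(2,1), of s' s] by (cases "s \<le> s'") auto
qed

section \<open>Antipodal vertices in two shadows and the count over all flips\<close>

definition opposite :: "complex set \<Rightarrow> complex set \<Rightarrow> complex set" where
  "opposite e f = {p \<in> shadow e. - p \<in> shadow f}"

lemma opposite_subset: "opposite e f \<subseteq> circle_points n"
  by (auto simp: opposite_def shadow_def)

lemma finite_opposite: "finite (opposite e f)"
  using finite_subset[OF opposite_subset card_circle_points(1)] .

lemma opposite_swap: "opposite f e = uminus ` opposite e f"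
proof
  show "opposite f e \<subseteq> uminus ` opposite e f"
  proof
    fix p assume "p \<in> opposite f e"
    then have "- p \<in> opposite e f" by (simp add: opposite_def)
    then show "p \<in> uminus ` opposite e f" by (metis imageI minus_minus)
  qed
qed (auto simp: opposite_def)

lemma card_opposite_swap: "card (opposite f e) = card (opposite e f)"
  unfolding opposite_swap[of f e] by (rule card_image) simp

lemma opposite_vtx:
  assumes "a < b" "b < a + int n" "c < d" "d < c + int n" "i \<in> {a..b}" "i + int n \<in> {c..d}"
  shows "P i \<in> opposite {P a, P b} {P c, P d}"
proof -
  have "- P i \<in> P ` {c..d}" unfolding vtx_antipode[symmetric] using assms(6) by (rule imageI)
  then show ?thesis using assms unfolding opposite_def by (simp add: shadow_eq)
qed

lemma centered_pair_opposite:
  assumes M: "M \<in> matchings n" and nd: "\<And>g. g \<in> M \<Longrightarrow> 0 \<notin> convex hull g"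
    and ef: "centered_pair M e f"
  shows "1 \<le> card (opposite e f)"
    and "flip M e f \<in> matchings n \<Longrightarrow> even n \<Longrightarrow> 2 \<le> card (opposite e f)"
proof -
  obtain a b c d where o: "e = {P a, P b}" "f = {P c, P d}" "a < b" "b < c" "c < d" "d < a + 2 * int n"
    "b < a + int n" "c \<le> b + int n" "d < c + int n" "a + int n \<le> d"
    by (rule centered_pair_gaps[OF assms])
  \<comment> \<open>The first vertex that the arc of \<open>e\<close> has in common with the arc of
    \<open>f\<close> turned back by a half circle; the gap bounds make the two arcs overlap.\<close>
  define m where "m = max a (c - int n)"
  have m: "m \<in> {a..b}" "m + int n \<in> {c..d}" using o by (auto simp: m_def)
  have mo: "P m \<in> opposite e f" unfolding o(1,2) by (rule opposite_vtx) (use o m in auto)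
  then show "1 \<le> card (opposite e f)" using finite_opposite[of e f] by (auto simp: Suc_le_eq card_gt_0_iff)
  assume fl: "flip M e f \<in> matchings n" and ev: "even n"
  note D = centered_pairD[OF ef]
  have fe: "{P b, P c} \<in> flip M e f" "{P d, P a} \<in> flip M e f"
    using flip_eq(1)[OF M D(1)[unfolded o] D(2)[unfolded o] o(3-6)] o(1,2) by auto
  \<comment> \<open>A gap of exactly \<open>n\<close> steps would make a new edge diametral, which
    no matching allows for even \<open>n\<close>. With both gaps shorter than that, the overlap
    contains \<open>m + 1\<close> as well.\<close>
  have ne: "c \<noteq> b + int n" "d \<noteq> a + int n"
    using diametral_edge_odd[OF fl, of b] diametral_edge_odd[OF fl, of a] fe ev by (auto simp: insert_commute)
  have m1: "m + 1 \<in> {a..b}" "m + 1 + int n \<in> {c..d}" using o ne by (auto simp: m_def)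
  have "P (m + 1) \<in> opposite e f" unfolding o(1,2) by (rule opposite_vtx) (use o m1 in auto)
  moreover have "P m \<noteq> P (m + 1)" using vtx_neq[of m "m + 1"] n2 by simp
  ultimately have "card {P m, P (m + 1)} \<le> card (opposite e f)" using mo by (intro card_mono finite_opposite) auto
  then show "2 \<le> card (opposite e f)" using \<open>P m \<noteq> P (m + 1)\<close> by simp
qed

text \<open>One pair is chosen for each neighbour, and \<open>S\<close> collects the vertices it
  uses in both orders. The sets are disjoint because a vertex \<open>p\<close> determines the edge
  that shadows it, and \<open>- p\<close> determines the partner.\<close>

lemma neighbours_opposite_partition:
  assumes M: "M \<in> matchings n" and nd: "\<And>g. g \<in> M \<Longrightarrow> 0 \<notin> convex hull g"
  obtains S where
    "\<And>M'. M' \<in> neighbours M \<Longrightarrow>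
       \<exists>e f. centered_pair M e f \<and> M' = flip M e f \<and> S M' = opposite e f \<union> opposite f e \<and>
             card (S M') = 2 * card (opposite e f)"
    "(\<Sum>M'\<in>neighbours M. card (S M')) = card (\<Union>(S ` neighbours M))"
    "\<Union>(S ` neighbours M) \<subseteq> circle_points n"
proof -
  have "\<forall>M'\<in>neighbours M. \<exists>q. centered_pair M (fst q) (snd q) \<and> M' = flip M (fst q) (snd q)"
    unfolding neighbours_def by auto
  then obtain q where q: "\<And>M'. M' \<in> neighbours M \<Longrightarrow>
      centered_pair M (fst (q M')) (snd (q M')) \<and> M' = flip M (fst (q M')) (snd (q M'))"
    by metis
  define S where "S = (\<lambda>M'. opposite (fst (q M')) (snd (q M')) \<union> opposite (snd (q M')) (fst (q M')))"
  have uniq: "e = e' \<and> f = f'"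
    if "centered_pair M e f" "centered_pair M e' f'" "p \<in> opposite e f" "p \<in> opposite e' f'" for e f e' f' p
    using centered_pair_shadow_unique[OF M nd that(1,2), of p]
      centered_pair_shadow_unique[OF M nd that(1,2)[THEN centered_pair_commute], of "- p"] that(3,4)
    by (auto simp: opposite_def)
  show thesis
  proof (rule that[of S])
    fix M' assume M': "M' \<in> neighbours M"
    let ?e = "fst (q M')" and ?f = "snd (q M')"
    have ef: "centered_pair M ?e ?f" "M' = flip M ?e ?f" using q[OF M'] by auto
    have "opposite ?e ?f \<inter> opposite ?f ?e = {}"
      using uniq[OF ef(1) centered_pair_commute[OF ef(1)]] centered_pairD(3)[OF ef(1)] by blast
    then have "card (S M') = 2 * card (opposite ?e ?f)"
      by (simp add: S_def card_Un_disjoint finite_opposite card_opposite_swap[of ?f ?e])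
    then show "\<exists>e f. centered_pair M e f \<and> M' = flip M e f \<and> S M' = opposite e f \<union> opposite f e \<and>
             card (S M') = 2 * card (opposite e f)"
      using ef S_def by blast
  next
    have dis: "S M1 \<inter> S M2 = {}" if "M1 \<in> neighbours M" "M2 \<in> neighbours M" "M1 \<noteq> M2" for M1 M2
    proof (rule ccontr)
      assume "S M1 \<inter> S M2 \<noteq> {}"
      then obtain p where p: "p \<in> S M1" "p \<in> S M2" by blast
      note q1 = q[OF that(1)] and q2 = q[OF that(2)]
      note q1' = centered_pair_commute[OF conjunct1[OF q1]] and q2' = centered_pair_commute[OF conjunct1[OF q2]]
      have "(fst (q M1) = fst (q M2) \<and> snd (q M1) = snd (q M2)) \<or> (fst (q M1) = snd (q M2) \<and> snd (q M1) = fst (q M2))"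
        using p unfolding S_def
        using uniq[OF conjunct1[OF q1] conjunct1[OF q2]] uniq[OF conjunct1[OF q1] q2']
          uniq[OF q1' conjunct1[OF q2]] uniq[OF q1' q2'] by blast
      \<comment> \<open>Pairs that agree up to order give the same flip.\<close>
      then have "M1 = M2" using q1 q2 flip_commute by metis
      then show False using that(3) by simp
    qed
    then show "(\<Sum>M'\<in>neighbours M. card (S M')) = card (\<Union>(S ` neighbours M))"
      by (intro card_UN_disjoint[symmetric]) (auto simp: finite_neighbours S_def finite_opposite)
    show "\<Union>(S ` neighbours M) \<subseteq> circle_points n" using opposite_subset unfolding S_def by blast
  qed
qed

lemma neighbours_bound:
  assumes M: "M \<in> matchings n"
  shows "card (neighbours M) \<le> (if even n then n div 2 else n)"
proof (cases "\<exists>g\<in>M. 0 \<in> convex hull g")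
  case True
  then obtain g where g: "g \<in> M" "0 \<in> convex hull g" by blast
  \<comment> \<open>A chord through the center has its ends exactly \<open>n\<close> steps apart,
    since otherwise it fits in an arc shorter than a half circle. Then \<open>n\<close> is odd, and
    the bound \<open>n - 1\<close> suffices.\<close>
  obtain a b where ab: "g = {P a, P b}" "0 \<le> a" "a < b" "b < 0 + 2 * int n"
    by (rule two_subset_vtx[OF matchingD[OF M g(1)], of 0])
  have "\<not> b < a + int n"
    using zero_notin_hull_half_circle[of g a b] g ab by auto
  moreover have "\<not> b > a + int n"
    using zero_notin_hull_half_circle[of g b "a + 2 * int n"] vtx_in_image[of b a "a + 2 * int n"]
      vtx_in_image[of b b "a + 2 * int n"] g ab by auto
  ultimately have "b = a + int n" by simp
  then have "odd n" using diametral_edge_odd[OF M, of a] g ab by simp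
  then show ?thesis using diametral_neighbours[OF M g] by simp
next
  case False
  then have nd: "\<And>g. g \<in> M \<Longrightarrow> 0 \<notin> convex hull g" by blast
  obtain S where S: "\<And>M'. M' \<in> neighbours M \<Longrightarrow>
       \<exists>e f. centered_pair M e f \<and> M' = flip M e f \<and> S M' = opposite e f \<union> opposite f e \<and>
             card (S M') = 2 * card (opposite e f)"
    "(\<Sum>M'\<in>neighbours M. card (S M')) = card (\<Union>(S ` neighbours M))"
    "\<Union>(S ` neighbours M) \<subseteq> circle_points n"
    by (rule neighbours_opposite_partition[OF M nd]) blast+
  \<comment> \<open>Both orders of the pair contribute, which doubles the bounds 1 and 2 on
    \<open>opposite e f\<close>.\<close>
  have "card (S M') \<ge> (if even n then 4 else 2)" if M': "M' \<in> neighbours M" for M'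
  proof -
    obtain e f where ef: "centered_pair M e f" "M' = flip M e f" "card (S M') = 2 * card (opposite e f)"
      using S(1)[OF M'] by metis
    have "flip M e f \<in> matchings n" using M' ef(2) by (simp add: neighbours_def)
    then show ?thesis using centered_pair_opposite[OF M nd ef(1)] ef(3) by auto
  qed
  then have "card (neighbours M) * (if even n then 4 else 2) \<le> (\<Sum>M'\<in>neighbours M. card (S M'))"
    by (intro sum_bounded_below[of "neighbours M" "if even n then 4 else 2 :: nat", simplified]) auto
  also have "\<dots> \<le> 2 * n" unfolding S(2)
    using card_mono[OF card_circle_points(1) S(3)] card_circle_points(2) by simp
  finally show ?thesis by (auto split: if_splits)
qed

text \<open>A shadow is an arc with at least two vertices, and it has a vertex in its interior
  unless the edge is a side of the polygon.\<close>

lemma shadow_neighbour: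
  assumes "M \<in> matchings n" "\<And>g. g \<in> M \<Longrightarrow> 0 \<notin> convex hull g" "centered_pair M e f" "P i \<in> shadow e"
  shows "P (i - 1) \<in> shadow e \<or> P (i + 1) \<in> shadow e"
    and "P i \<notin> e \<Longrightarrow> P (i - 1) \<in> shadow e \<and> P (i + 1) \<in> shadow e"
    and "P i \<in> e \<Longrightarrow> e = {P i, P (i + 1)} \<or> e = {P (i - 1), P i} \<or> (\<exists>j. P j \<in> shadow e \<and> P j \<notin> e)"
proof -
  obtain a b c d where o: "e = {P a, P b}" "a < b" "b < a + int n"
    by (rule centered_pair_gaps[OF assms(1-3)])
  have sh: "shadow e = P ` {a..b}" unfolding o(1) by (rule shadow_eq) (use o in auto)
  then obtain j where j: "P i = P j" "j \<in> {a..b}" using assms(4) by auto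
  have s: "P (i - 1) = P (j - 1)" "P (i + 1) = P (j + 1)" using j(1) by (simp_all add: vtx_eq_iff)
  have "j - 1 \<in> {a..b} \<or> j + 1 \<in> {a..b}" using j o by auto
  then show "P (i - 1) \<in> shadow e \<or> P (i + 1) \<in> shadow e" unfolding sh s by blast
  show "P (i - 1) \<in> shadow e \<and> P (i + 1) \<in> shadow e" if "P i \<notin> e"
  proof -
    have "j \<noteq> a" "j \<noteq> b" using that j o by auto
    then have "j - 1 \<in> {a..b}" "j + 1 \<in> {a..b}" using j by auto
    then show ?thesis unfolding sh s by blast
  qed
  show "e = {P i, P (i + 1)} \<or> e = {P (i - 1), P i} \<or> (\<exists>j. P j \<in> shadow e \<and> P j \<notin> e)" if "P i \<in> e"
  proof (cases "b = a + 1")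
    case True
    then have "j = a \<or> j = b" using j by auto
    then show ?thesis using True s j(1) o(1) by auto
  next
    case False
    have "P (a + 1) \<in> shadow e" unfolding sh using o by auto
    moreover have "P (a + 1) \<notin> e" using False o vtx_neq[of a "a + 1"] vtx_neq[of "a + 1" b] by auto
    ultimately show ?thesis by blast
  qed
qed

text \<open>The equality case of the count: each of the \<open>n\<close> neighbours takes at least
  two of the \<open>2 * n\<close> vertices, so each takes exactly two and no vertex is left
  over.\<close>

lemma extremal_edges_adjacent:
  assumes M: "M \<in> matchings n" and card: "card (neighbours M) = n" and p: "e \<in> M" "P i \<in> e"
  shows "e = {P i, P (i + 1)} \<or> e = {P (i - 1), P i}"
proof -
  have nd: "0 \<notin> convex hull g" if "g \<in> M" for g
    using diametral_neighbours[OF M that] card n2 by auto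
  obtain S where S: "\<And>M'. M' \<in> neighbours M \<Longrightarrow>
       \<exists>e f. centered_pair M e f \<and> M' = flip M e f \<and> S M' = opposite e f \<union> opposite f e \<and>
             card (S M') = 2 * card (opposite e f)"
    "(\<Sum>M'\<in>neighbours M. card (S M')) = card (\<Union>(S ` neighbours M))"
    "\<Union>(S ` neighbours M) \<subseteq> circle_points n"
    by (rule neighbours_opposite_partition[OF M nd]) blast+
  have ge: "2 \<le> card (S M')" if "M' \<in> neighbours M" for M'
    using S(1)[OF that] centered_pair_opposite(1)[OF M nd] by fastforce
  have le: "(\<Sum>M'\<in>neighbours M. card (S M')) \<le> 2 * n" unfolding S(2)
    using card_mono[OF card_circle_points(1) S(3)] card_circle_points(2) by simp
  have eq: "(\<Sum>M'\<in>neighbours M. card (S M')) = (\<Sum>M'\<in>neighbours M. 2)"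
  proof (rule antisym)
    show "(\<Sum>M'\<in>neighbours M. 2) \<le> (\<Sum>M'\<in>neighbours M. card (S M'))" by (rule sum_mono) (rule ge)
  qed (use le card in simp)
  then have S2: "card (S M') = 2" if "M' \<in> neighbours M" for M'
    using sum_mono_inv[of "\<lambda>_. 2" "neighbours M" "\<lambda>M'. card (S M')" M'] ge finite_neighbours that by auto
  have "\<Union>(S ` neighbours M) = circle_points n"
    by (rule card_subset_eq[OF card_circle_points(1) S(3)]) (use S(2) eq card card_circle_points(2) in simp)
  then have cover: "\<exists>e f. centered_pair M e f \<and> P j \<in> opposite e f \<and> card (opposite e f) = 1" for j
  proof -
    have "P j \<in> \<Union>(S ` neighbours M)" using \<open>\<Union>(S ` neighbours M) = circle_points n\<close> circle_points_range by auto
    then obtain M' where M': "M' \<in> neighbours M" "P j \<in> S M'" by blast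
    obtain e f where "centered_pair M e f" "S M' = opposite e f \<union> opposite f e" "card (S M') = 2 * card (opposite e f)"
      using S(1)[OF M'(1)] by metis
    then show ?thesis using S2[OF M'(1)] M'(2) card_opposite_swap[of f e] centered_pair_commute
      by (metis Un_iff mult_cancel_left1 numeral_eq_one_iff semiring_norm(85) zero_neq_numeral mult_cancel1 mult.right_neutral)
  qed
  \<comment> \<open>The antipodes of \<open>P (j - 1)\<close>, \<open>P j\<close>, \<open>P (j + 1)\<close> lie in shadows of three different edges, but no
    shadow consists of the middle antipode alone.\<close>
  have no_interior: False if ef: "centered_pair M e f" "P j \<in> shadow e" "P j \<notin> e" for e f j
  proof -
    have sh: "P (j - 1) \<in> shadow e" "P (j + 1) \<in> shadow e"
      using shadow_neighbour(2)[OF M nd ef(1,2)] ef(3) by auto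
    \<comment> \<open>The pair that takes \<open>P k\<close> must have \<open>e\<close> as its first
      edge, since shadows of such edges do not overlap.\<close>
    have own: "\<exists>f. centered_pair M e f \<and> P k \<in> opposite e f \<and> card (opposite e f) = 1" if "P k \<in> shadow e" for k
    proof -
      obtain e' f' where ef': "centered_pair M e' f'" "P k \<in> opposite e' f'" "card (opposite e' f') = 1"
        using cover by blast
      have "e' = e"
        using centered_pair_shadow_unique[OF M nd ef'(1) ef(1), of "P k"] ef'(2) that by (simp add: opposite_def)
      then show ?thesis using ef' by blast
    qed
    obtain f0 f1 f2 where f0: "centered_pair M e f0" "P (j - 1) \<in> opposite e f0" "card (opposite e f0) = 1"
      and f1: "centered_pair M e f1" "P j \<in> opposite e f1" "card (opposite e f1) = 1"
      and f2: "centered_pair M e f2" "P (j + 1) \<in> opposite e f2" "card (opposite e f2) = 1"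
      using own[OF sh(1)] own[OF ef(2)] own[OF sh(2)] by blast
    have ne: "P j \<noteq> P (j - 1)" "P j \<noteq> P (j + 1)" using vtx_neq[of "j - 1" j] vtx_neq[of j "j + 1"] n2 by auto
    have single: "x = y" if "card (opposite e f1) = 1" "x \<in> opposite e f1" "y \<in> opposite e f1" for x y
      using that by (metis card_1_singletonE singletonD)
    have "f1 \<noteq> f0" "f1 \<noteq> f2" using single[OF f1(3) f1(2)] ne f0(2) f2(2) by auto
    have f1j: "P (j + int n) \<in> shadow f1" using f1(2) by (simp add: opposite_def vtx_antipode)
    have "P (j + int n - 1) \<in> shadow f1 \<or> P (j + int n + 1) \<in> shadow f1"
      using shadow_neighbour(1)[OF M nd centered_pair_commute[OF f1(1)] f1j] by simp
    moreover have "P (j + int n - 1) \<in> shadow f0" "P (j + int n + 1) \<in> shadow f2"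
      using f0(2) f2(2) vtx_antipode[of "j - 1"] vtx_antipode[of "j + 1"]
      by (simp_all add: opposite_def algebra_simps)
    ultimately show False
      using \<open>f1 \<noteq> f0\<close> \<open>f1 \<noteq> f2\<close>
        centered_pair_shadow_unique[OF M nd centered_pair_commute[OF f1(1)] centered_pair_commute[OF f0(1)]]
        centered_pair_shadow_unique[OF M nd centered_pair_commute[OF f1(1)] centered_pair_commute[OF f2(1)]]
      by blast
  qed
  \<comment> \<open>The edge whose shadow takes \<open>P i\<close> has no interior shadow vertices,
    so \<open>P i\<close> is one of its ends and it coincides with \<open>e\<close>.\<close>
  obtain e' f' where ef': "centered_pair M e' f'" "P i \<in> opposite e' f'" using cover by blast
  then have sh: "P i \<in> shadow e'" by (simp add: opposite_def)
  have "P i \<in> e'" using no_interior[OF ef'(1) sh] by blast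
  then have "e' = e" using matching_disjoint[OF M p(1) centered_pairD(1)[OF ef'(1)]] p(2) by blast
  then show ?thesis
    using shadow_neighbour(3)[OF M nd ef'(1) sh \<open>P i \<in> e'\<close>] no_interior[OF ef'(1)] by blast
qed

section \<open>Matchings of perimeter edges\<close>

text \<open>Disjointness of the hulls already makes the edge at each point unique, so only existence
  is asked for.\<close>

lemma matchingI:
  assumes "\<And>e. e \<in> M \<Longrightarrow> e \<subseteq> circle_points n \<and> card e = 2"
    and "\<And>p. p \<in> circle_points n \<Longrightarrow> \<exists>e\<in>M. p \<in> e"
    and disj: "\<And>e f. e \<in> M \<Longrightarrow> f \<in> M \<Longrightarrow> e \<noteq> f \<Longrightarrow> convex hull e \<inter> convex hull f = {}"
  shows "M \<in> matchings n"
proof -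
  have "\<exists>!e. e \<in> M \<and> p \<in> e" if p: "p \<in> circle_points n" for p
  proof -
    obtain e where e: "e \<in> M" "p \<in> e" using assms(2)[OF p] by blast
    show ?thesis
    proof (rule ex1I[of _ e])
      fix f assume f: "f \<in> M \<and> p \<in> f"
      show "f = e"
      proof (rule ccontr)
        assume "f \<noteq> e"
        then have "f \<inter> e = {}" using disj[of f e] f e by (auto dest: hulls_disjoint_imp_disjoint)
        then show False using e f by blast
      qed
    qed (use e in simp)
  qed
  then show ?thesis using assms unfolding matchings_def mem_Collect_eq by simp
qed

definition side :: "int \<Rightarrow> complex set" where
  "side i = {P i, P (i + 1)}"

lemma side_circle: "side i \<subseteq> circle_points n"
  by (auto simp: side_def circle_points_range)

lemma card_side: "card (side i) = 2"
  using vtx_neq[of i "i + 1"] n2 by (simp add: side_def)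

lemma side_cong:
  assumes "P i = P k"
  shows "side i = side k"
proof -
  have "P (i + 1) = P (k + 1)" using assms by (simp add: vtx_eq_iff)
  then show ?thesis using assms by (simp add: side_def)
qed

text \<open>The parity of an index depends on the vertex alone because the period
  \<open>2 * n\<close> is even. This is what tells the two perimeter matchings apart.\<close>

lemma vtx_even: "P i = P k \<Longrightarrow> even (i - k)"
  unfolding vtx_eq_iff by (rule dvd_mult_left)

lemma vtx_mem_side:
  assumes "P i \<in> side k"
  shows "side k = side i \<or> side k = side (i - 1)"
proof -
  have "P i = P k \<or> P (i - 1) = P k" using assms by (auto simp: side_def vtx_eq_iff algebra_simps)
  then show ?thesis using side_cong by metis
qed

lemma side_eq_iff:
  assumes "even (i - k)"
  shows "side i = side k \<longleftrightarrow> 2 * int n dvd i - k"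
proof
  assume "side i = side k"
  then have "P i = P k \<or> P i = P (k + 1)" by (auto simp: side_def)
  moreover have "P i \<noteq> P (k + 1)" using vtx_even[of i "k + 1"] assms by auto
  ultimately show "2 * int n dvd i - k" by (simp add: vtx_eq_iff)
qed (simp add: side_cong vtx_eq_iff)

lemma ori_side_pos:
  assumes "x \<in> circle_points n" "x \<notin> side i"
  shows "ori (P i) (P (i + 1)) x > 0"
proof -
  obtain k where k: "x = P k" "i \<le> k" "k < i + 2 * int n"
    using assms(1) vtx_index_in[of i] unfolding circle_points_range by (metis rangeE)
  have "k \<noteq> i" "k \<noteq> i + 1" using assms(2) k(1) by (auto simp: side_def)
  then show ?thesis unfolding k(1) using k by (intro ori_vtx_pos) auto
qed

lemma side_hull_disjoint:
  "T \<subseteq> circle_points n \<Longrightarrow> T \<inter> side i = {} \<Longrightarrow> convex hull (side i) \<inter> convex hull T = {}"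
  unfolding side_def[of i] by (rule hulls_disjoint_ori, rule ori_side_pos) (auto simp: side_def)

text \<open>Only the parity of \<open>j\<close> matters; keeping it free lets any side serve as the
  starting point.\<close>

definition perimeter :: "int \<Rightarrow> complex set set" where
  "perimeter j = side ` {i. even (i - j)}"

lemma side_disjoint:
  assumes "even (i - k)" "side i \<noteq> side k"
  shows "side i \<inter> side k = {}"
proof -
  have "P i \<noteq> P k" "P (i + 1) \<noteq> P (k + 1)" using assms(2) side_cong[of i k] by (auto simp: vtx_eq_iff)
  moreover have "P i \<noteq> P (k + 1)" using vtx_even[of i "k + 1"] assms(1) by auto
  moreover have "P (i + 1) \<noteq> P k" using vtx_even[of "i + 1" k] assms(1) by auto
  ultimately show ?thesis by (auto simp: side_def)
qed

lemma perimeter_disjoint: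
  assumes "e \<in> perimeter j" "f \<in> perimeter j" "e \<noteq> f"
  shows "e \<inter> f = {}"
proof -
  obtain i k where "e = side i" "f = side k" "even (i - j)" "even (k - j)"
    using assms(1,2) unfolding perimeter_def by auto
  moreover from this have "even (i - k)" by presburger
  ultimately show ?thesis using assms(3) side_disjoint by simp
qed

lemma perimeter_covers:
  assumes "p \<in> circle_points n"
  shows "\<exists>e\<in>perimeter j. p \<in> e"
proof -
  obtain i where i: "p = P i" using assms circle_points_range by auto
  show ?thesis
  proof (cases "even (i - j)")
    case True
    then show ?thesis using i by (auto simp: perimeter_def side_def)
  next
    case False
    then have "even (i - 1 - j)" by presburger
    moreover have "p \<in> side (i - 1)" using i by (simp add: side_def)
    ultimately show ?thesis unfolding perimeter_def by blast
  qed
qed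

lemma perimeter_matching: "perimeter j \<in> matchings n"
proof (rule matchingI)
  fix e f assume ef: "e \<in> perimeter j" "f \<in> perimeter j" "e \<noteq> f"
  obtain i where i: "e = side i" using ef(1) unfolding perimeter_def by blast
  have "f \<subseteq> circle_points n" using ef(2) side_circle unfolding perimeter_def by auto
  moreover have "f \<inter> side i = {}" using perimeter_disjoint[OF ef] i by blast
  ultimately show "convex hull e \<inter> convex hull f = {}" unfolding i by (rule side_hull_disjoint)
qed (use side_circle card_side perimeter_covers in \<open>auto simp: perimeter_def\<close>)

text \<open>The assumption \<open>anti\<close> supplies two antipodal vertices, hence the center.
  The second conclusion recovers the flipped pair from the result, which later shows that different
  pairs give different neighbours.\<close>

lemma perimeter_flip:
  assumes ij: "even (i - j)" and kj: "even (k - j)" and ik: "i + 1 < k" "k + 1 < i + 2 * int n"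
    and anti: "k = i + int n \<or> k + 1 = i + int n"
  shows "flip (perimeter j) (side i) (side k) \<in> neighbours (perimeter j)"
    and "perimeter j - flip (perimeter j) (side i) (side k) = {side i, side k}"
proof -
  let ?M = "perimeter j"
  let ?g = "{P (i + 1), P k}" and ?h = "{P (k + 1), P i}"
  have mem: "side i \<in> ?M" "side k \<in> ?M" using ij kj by (auto simp: perimeter_def)
  have F: "flip ?M (side i) (side k) = (?M - {side i, side k}) \<union> {?g, ?h}" "?g \<notin> ?M" "?h \<notin> ?M"
    unfolding side_def
    by (rule flip_eq[OF perimeter_matching mem[unfolded side_def]]; use ik in simp)+
  show "?M - flip ?M (side i) (side k) = {side i, side k}"
    unfolding F(1) using F(2,3) mem by auto
  have un: "?g \<union> ?h = side i \<union> side k" by (auto simp: side_def)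
  have ne: "side i \<noteq> side k"
  proof -
    have "P i \<noteq> P k" "P i \<noteq> P (k + 1)" using vtx_neq[of i k] vtx_neq[of i "k + 1"] ik by auto
    then show ?thesis by (auto simp: side_def)
  qed
  \<comment> \<open>All vertices outside a side lie strictly on one side of its line. This yields
    both the emptiness of the quadrilateral and the disjointness of old and new edges.\<close>
  have old: "convex hull e \<inter> convex hull T = {}"
    if e: "e \<in> ?M - {side i, side k}" and T: "T \<subseteq> side i \<union> side k" for e T
  proof -
    obtain m where m: "e = side m" using e unfolding perimeter_def by blast
    have "e \<inter> (side i \<union> side k) = {}"
      using perimeter_disjoint[of e j "side i"] perimeter_disjoint[of e j "side k"] e mem by auto
    then show ?thesis using T side_circle unfolding m
      by (intro side_hull_disjoint) (meson Un_least order_trans, blast)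
  qed
  have gh: "convex hull ?g \<inter> convex hull ?h = {}"
    by (rule hulls_disjoint_ori)
       (use ik ori_vtx_pos[of "i + 1" k "k + 1"] ori_vtx_pos[of "i + 1" k "i + 2 * int n"] in auto)
  have gsub: "?g \<subseteq> side i \<union> side k" and hsub: "?h \<subseteq> side i \<union> side k" by (auto simp: side_def)
  have "flip ?M (side i) (side k) \<in> matchings n"
    unfolding F(1)
  proof (rule matchingI)
    fix e assume "e \<in> ?M - {side i, side k} \<union> {?g, ?h}"
    then consider "e \<in> ?M" | "e = ?g" | "e = ?h" by blast
    then show "e \<subseteq> circle_points n \<and> card e = 2"
    proof cases
      case 1
      then show ?thesis using matchingD[OF perimeter_matching] by simp
    next
      case 2
      then show ?thesis using vtx_neq[of "i + 1" k] ik by (simp add: circle_points_range)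
    next
      case 3
      then show ?thesis using vtx_neq[of i "k + 1"] ik by (auto simp: circle_points_range)
    qed
  next
    fix p assume p: "p \<in> circle_points n"
    obtain e where e: "e \<in> ?M" "p \<in> e" using perimeter_covers[OF p] by blast
    show "\<exists>e\<in>?M - {side i, side k} \<union> {?g, ?h}. p \<in> e"
    proof (cases "e \<in> {side i, side k}")
      case True
      then have "p \<in> ?g \<union> ?h" unfolding un using e by auto
      then consider "p \<in> ?g" | "p \<in> ?h" by (rule UnE)
      then show ?thesis by cases (rule bexI, assumption, simp)+
    next
      case False
      then show ?thesis using e by blast
    qed
  next
    fix e f assume ef: "e \<in> ?M - {side i, side k} \<union> {?g, ?h}" "f \<in> ?M - {side i, side k} \<union> {?g, ?h}" "e \<noteq> f"
    define X Y where "X = ?M - {side i, side k}" and "Y = {?g, ?h}"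
    have sub: "T \<subseteq> side i \<union> side k" if "T \<in> Y" for T using that gsub hsub unfolding Y_def by auto
    have "e \<in> X \<or> e \<in> Y" "f \<in> X \<or> f \<in> Y" using ef(1,2) unfolding X_def Y_def by (simp_all only: Un_iff)
    then consider "e \<in> X" "f \<in> X" | "e \<in> X" "f \<in> Y" | "e \<in> Y" "f \<in> X" | "e \<in> Y" "f \<in> Y"
      by blast
    then show "convex hull e \<inter> convex hull f = {}"
    proof cases
      case 1
      then show ?thesis using matching_hulls_disjoint[OF perimeter_matching[of j] _ _ ef(3)] by (simp add: X_def)
    next
      case 2
      then show ?thesis using old[OF _ sub] by (simp add: X_def)
    next
      case 3
      then show ?thesis using old[of f, OF _ sub[of e]] by (simp add: X_def Int_commute)
    next
      case 4
      then have "e = ?g \<and> f = ?h \<or> e = ?h \<and> f = ?g" using ef(3) by (auto simp: Y_def)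
      then show ?thesis using gh by (auto simp: Int_commute)
    qed
  qed
  moreover have "empty_quadrilateral ?M (side i) (side k)"
    unfolding empty_quadrilateral_def using mem ne old[OF _ order_refl] by simp
  moreover have "0 \<in> convex hull (side i \<union> side k)"
    using anti by (intro zero_in_hull_antipodal[of i]) (auto simp: side_def)
  ultimately show "flip ?M (side i) (side k) \<in> neighbours ?M"
    unfolding neighbours_def centered_pair_def mem_Collect_eq by metis
qed

text \<open>For odd \<open>n\<close> the side opposite to \<open>side i\<close> has the wrong
  parity, so the partner is \<open>side (i + n - 1)\<close>, which ends at the antipode of
  \<open>P i\<close>. Starting from each of the \<open>n\<close> sides gives \<open>n\<close>
  different unordered pairs.\<close>

lemma perimeter_neighbours_odd:
  assumes "odd n" "n \<ge> 3"
  shows "n \<le> card (neighbours (perimeter j))"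
proof -
  define G where "G m = flip (perimeter j) (side (2 * m + j)) (side (2 * m + j + int n - 1))" for m
  have ev: "even (2 * m + j + int n - 1 - j)" for m using assms(1) by simp
  have G: "G m \<in> neighbours (perimeter j)"
    "perimeter j - G m = {side (2 * m + j), side (2 * m + j + int n - 1)}" for m
    unfolding G_def by (rule perimeter_flip; use assms ev[of m] in simp)+
  have "inj_on G {0..<int n}"
  proof (rule inj_onI)
    fix x y assume x: "x \<in> {0..<int n}" and y: "y \<in> {0..<int n}" and "G x = G y"
    then have eq: "{side (2 * x + j), side (2 * x + j + int n - 1)} = {side (2 * y + j), side (2 * y + j + int n - 1)}"
      using G(2) by metis
    have e: "even (2 * x + j - (2 * y + j))" "even (2 * x + j - (2 * y + j + int n - 1))"
       "even (2 * x + j + int n - 1 - (2 * y + j))"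
      using assms(1) by auto
    from eq consider "side (2 * x + j) = side (2 * y + j)"
      | "side (2 * x + j) = side (2 * y + j + int n - 1)" "side (2 * x + j + int n - 1) = side (2 * y + j)"
      by (auto simp: doubleton_eq_iff)
    then show "x = y"
    proof cases
      case 1
      then have "2 * int n dvd 2 * (x - y)" using side_eq_iff[OF e(1)] by (simp add: right_diff_distrib)
      then have "int n dvd x - y" unfolding dvd_mult_cancel_left by simp
      then show ?thesis using x y zdvd_not_zless[of "x - y" "int n"] zdvd_not_zless[of "y - x" "int n"]
        by (cases x y rule: linorder_cases) (auto simp: dvd_diff_commute)
    next
      case 2
      then have "2 * int n dvd (2 * x + j - (2 * y + j + int n - 1))" "2 * int n dvd (2 * x + j + int n - 1 - (2 * y + j))"
        using side_eq_iff[OF e(2)] side_eq_iff[OF e(3)] by auto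
      \<comment> \<open>Two pairs that coincide in swapped order would close up after two steps of
        length \<open>n - 1\<close>, which is less than a full turn.\<close>
      from dvd_diff[OF this(2,1)] have "2 * int n dvd 2 * (int n - 1)" by (simp add: algebra_simps)
      then have "int n dvd int n - 1" unfolding dvd_mult_cancel_left by simp
      then show ?thesis using zdvd_not_zless[of "int n - 1" "int n"] n2 by auto
    qed
  qed
  then have "card (G ` {0..<int n}) = n" by (simp add: card_image)
  moreover have "card (G ` {0..<int n}) \<le> card (neighbours (perimeter j))"
    by (rule card_mono) (use G(1) finite_neighbours in auto)
  ultimately show ?thesis by simp
qed

text \<open>For even \<open>n\<close> the opposite side \<open>side (i + n)\<close> has the right
  parity. Each pair arises from both of its members, so \<open>m\<close> runs over half of the sides
  only.\<close>

lemma perimeter_neighbours_even: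
  assumes "even n"
  shows "n div 2 \<le> card (neighbours (perimeter j))"
proof -
  define G where "G m = flip (perimeter j) (side (2 * m + j)) (side (2 * m + j + int n))" for m
  have ev: "even (2 * m + j + int n - j)" for m using assms(1) by simp
  have G: "G m \<in> neighbours (perimeter j)"
    "perimeter j - G m = {side (2 * m + j), side (2 * m + j + int n)}" for m
    unfolding G_def by (rule perimeter_flip; use n2 ev[of m] in simp)+
  have "inj_on G {0..<int (n div 2)}"
  proof (rule inj_onI)
    fix x y assume x: "x \<in> {0..<int (n div 2)}" and y: "y \<in> {0..<int (n div 2)}" and "G x = G y"
    then have eq: "{side (2 * x + j), side (2 * x + j + int n)} = {side (2 * y + j), side (2 * y + j + int n)}"
      using G(2) by metis
    have xy: "0 \<le> 2 * x" "2 * x < int n" "0 \<le> 2 * y" "2 * y < int n" using x y assms by auto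
    have e: "even (2 * x + j - (2 * y + j))" "even (2 * y + j + int n - (2 * x + j))"
      using assms(1) by auto
    from eq consider "side (2 * x + j) = side (2 * y + j)" | "side (2 * y + j + int n) = side (2 * x + j)"
      by (auto simp: doubleton_eq_iff)
    then show "x = y"
    proof cases
      case 1
      then have "2 * int n dvd 2 * (x - y)" using side_eq_iff[OF e(1)] by (simp add: right_diff_distrib)
      then have "int n dvd x - y" unfolding dvd_mult_cancel_left by simp
      then show ?thesis using xy zdvd_not_zless[of "x - y" "int n"] zdvd_not_zless[of "y - x" "int n"]
        by (cases x y rule: linorder_cases) (auto simp: dvd_diff_commute)
    next
      case 2
      then have "2 * int n dvd 2 * y + j + int n - (2 * x + j)" using side_eq_iff[OF e(2)] by simp
      then show ?thesis using zdvd_not_zless[of "2 * y + j + int n - (2 * x + j)" "2 * int n"] xy by auto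
    qed
  qed
  then have "card (G ` {0..<int (n div 2)}) = n div 2" by (simp add: card_image)
  moreover have "card (G ` {0..<int (n div 2)}) \<le> card (neighbours (perimeter j))"
    by (rule card_mono) (use G(1) finite_neighbours in auto)
  ultimately show ?thesis by simp
qed

text \<open>Once \<open>side i\<close> is present, \<open>P (i + 1)\<close> is taken and
  \<open>P (i + 2)\<close> has to be matched forward. This propagates around the polygon, and equal
  cardinality turns the inclusion into equality.\<close>

lemma sides_matching_eq_perimeter:
  assumes M: "M \<in> matchings n" and sides: "\<And>e. e \<in> M \<Longrightarrow> \<exists>k. e = side k" and j: "side j \<in> M"
  shows "M = perimeter j"
proof -
  have step: "side (i + 2) \<in> M" if "side i \<in> M" for i
  proof -
    have "P (i + 2) \<in> circle_points n" by (simp add: circle_points_range)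
    then obtain e where e: "e \<in> M" "P (i + 2) \<in> e" by (rule matching_covers[OF M])
    obtain k where "e = side k" using sides[OF e(1)] by blast
    then have "e = side (i + 2) \<or> e = side (i + 1)" using vtx_mem_side[of "i + 2" k] e(2) by (auto simp: algebra_simps)
    moreover have "e \<noteq> side (i + 1)"
    proof
      assume "e = side (i + 1)"
      then have "P (i + 1) \<in> e \<inter> side i" by (simp add: side_def)
      then have "e = side i" using matching_disjoint[OF M e(1) that] by blast
      then have "P (i + 2) = P i \<or> P (i + 2) = P (i + 1)" using e(2) by (simp add: side_def)
      then show False using vtx_neq[of i "i + 2"] vtx_neq[of "i + 1" "i + 2"] n2 by auto
    qed
    ultimately show ?thesis using e(1) by simp
  qed
  have steps: "side (j + 2 * int m) \<in> M" for m
  proof (induction m)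
    case (Suc m)
    from step[OF this] show ?case by (simp add: algebra_simps)
  qed (use j in simp)
  have "perimeter j \<subseteq> M"
  proof
    fix e assume "e \<in> perimeter j"
    then obtain i where i: "e = side i" "even (i - j)" unfolding perimeter_def by blast
    \<comment> \<open>A nonnegative even representative of \<open>i - j\<close>, reachable by the
      induction over natural numbers above.\<close>
    define r where "r = (i - j) mod (2 * int n)"
    have "even r" unfolding r_def using i(2) by (simp add: dvd_mod)
    moreover have "r \<ge> 0" unfolding r_def using n2 by simp
    ultimately obtain m where m: "r = 2 * int m" by (metis evenE nonneg_int_cases zero_le_mult_iff zero_less_numeral not_less)
    have "2 * int n dvd (i - j) - r" unfolding r_def by (rule dvd_minus_mod)
    then have "P i = P (j + 2 * int m)" unfolding vtx_eq_iff m by (simp add: algebra_simps)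
    then show "e \<in> M" using side_cong steps[of m] i(1) by metis
  qed
  then show ?thesis
    using card_subset_eq[OF finite_matching[OF M]] card_matching[OF M] card_matching[OF perimeter_matching] by metis
qed

lemma perimeter_minus_one: "perimeter (- 1) = perimeter 1"
  by (simp add: perimeter_def)

lemma all_sides_iff:
  assumes M: "M \<in> matchings n"
  shows "(\<forall>e\<in>M. \<exists>k. e = side k) \<longleftrightarrow> M = perimeter 0 \<or> M = perimeter 1"
proof
  assume A: "\<forall>e\<in>M. \<exists>k. e = side k"
  have "P 0 \<in> circle_points n" by (simp add: circle_points_range)
  then obtain e where e: "e \<in> M" "P 0 \<in> e" by (rule matching_covers[OF M])
  then obtain k where "e = side k" using A by blast
  then have "side 0 \<in> M \<or> side (- 1) \<in> M" using vtx_mem_side[of 0 k] e by auto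
  then show "M = perimeter 0 \<or> M = perimeter 1"
    using sides_matching_eq_perimeter[OF M, of 0] sides_matching_eq_perimeter[OF M, of "- 1"] A perimeter_minus_one by auto
qed (auto simp: perimeter_def)

text \<open>Parity would force \<open>side 0\<close> to equal a side of odd index with its ends
  exchanged, which makes \<open>2 * n\<close> divide 2.\<close>

lemma perimeter_0_neq_1: "perimeter 0 \<noteq> perimeter 1"
proof
  assume "perimeter 0 = perimeter 1"
  moreover have "side 0 \<in> perimeter 0" by (simp add: perimeter_def)
  ultimately obtain k where k: "side 0 = side k" "even (k - 1)" unfolding perimeter_def by auto
  have "P 0 \<noteq> P k" using vtx_even[of 0 k] k(2) by auto
  then have "P 0 = P (k + 1)" "P 1 = P k" using k(1) by (auto simp: side_def doubleton_eq_iff)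
  then have "2 * int n dvd - (k + 1)" "2 * int n dvd 1 - k" by (simp_all add: vtx_eq_iff)
  from dvd_diff[OF this(2,1)] have "2 * int n dvd 2" by simp
  then show False using zdvd_not_zless[of 2 "2 * int n"] n2 by auto
qed

text \<open>A vertex strictly beyond the line of \<open>e\<close> belongs to an edge lying wholly
  there, so a half-plane without edges contains no vertices and the ends of \<open>e\<close> are
  adjacent.\<close>

lemma perimeter_edge_iff:
  assumes M: "M \<in> matchings n" and e: "e \<in> M"
  shows "perimeter_edge M e \<longleftrightarrow> (\<exists>k. e = side k)"
proof -
  define L where "L a b = {f \<in> M - {e}. convex hull f \<subseteq> left_side a b}" for a b
  define K where "K = {card (L a b) | a b. e = {a, b}}"
  have fin: "finite K"
  proof (rule finite_subset)
    show "K \<subseteq> {..card M}"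
      unfolding K_def L_def using finite_matching[OF M] by (auto intro: card_mono)
  qed simp
  have len: "edge_length M e = Min K" by (simp add: edge_length_def K_def L_def)
  show ?thesis
  proof
    assume "perimeter_edge M e"
    then have "Min K = 0" using len by (simp add: perimeter_edge_def)
    moreover have "K \<noteq> {}" using matchingD(2)[OF M e] unfolding K_def card_2_iff by blast
    ultimately have "0 \<in> K" using Min_in[OF fin] by simp
    then obtain a b where ab: "e = {a, b}" "card (L a b) = 0" unfolding K_def by auto
    have "finite (L a b)" unfolding L_def using finite_matching[OF M] by simp
    then have empty: "L a b = {}" using ab(2) by simp
    have "a \<noteq> b" using matchingD(2)[OF M e] ab(1) by auto
    have "a \<in> range P" "b \<in> range P" using matchingD(1)[OF M e] ab(1) circle_points_range by auto
    then obtain x where x: "a = P x" by blast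
    obtain y where y: "b = P y" "x \<le> y" "y < x + 2 * int n"
      using \<open>b \<in> range P\<close> vtx_index_in[of x] by (metis rangeE)
    have "x \<noteq> y" using \<open>a \<noteq> b\<close> x y by auto
    have "\<not> y + 1 < x + 2 * int n"
    proof
      assume y1: "y + 1 < x + 2 * int n"
      have "P (y + 1) \<in> circle_points n" by (simp add: circle_points_range)
      then obtain f where f: "f \<in> M" "P (y + 1) \<in> f" by (rule matching_covers[OF M])
      have "P (y + 1) \<noteq> P y" "P (y + 1) \<noteq> P x"
        using vtx_neq[of y "y + 1"] vtx_neq[of x "y + 1"] y y1 n2 by auto
      then have fe: "f \<noteq> e" using f(2) ab(1) x y by auto
      \<comment> \<open>The same edge written for the arc from \<open>y\<close> on to
        \<open>x\<close> one turn later, whose inner vertices are those to the left of the line from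
        \<open>a\<close> to \<open>b\<close>.\<close>
      have e': "e = {P y, P (x + 2 * int n)}" using ab x y by auto
      have "f \<subseteq> P ` {y<..<x + 2 * int n} \<or> f \<inter> P ` {y<..<x + 2 * int n} = {}"
        by (rule matching_edge_side[OF M]) (use e e' f fe y \<open>x \<noteq> y\<close> in auto)
      then have fs: "f \<subseteq> P ` {y<..<x + 2 * int n}" using f(2) y1 by auto
      have "convex hull f \<subseteq> left_side a b"
        unfolding left_side_ori
      proof (rule hull_ori_pos)
        fix z assume "z \<in> f"
        then obtain k where "z = P k" "y < k" "k < x + 2 * int n" using fs by auto
        then show "ori a b z > 0" using x y \<open>x \<noteq> y\<close> ori_vtx_pos[of x y k] by simp
      qed
      then have "f \<in> L a b" using f(1) fe by (simp add: L_def)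
      then show False using empty by simp
    qed
    then have "y = x - 1 + 2 * int n" using y by simp
    then have "e = side (x - 1)" using ab(1) x y(1) vtx_periodic[of "x - 1"] by (simp add: side_def insert_commute)
    then show "\<exists>k. e = side k" ..
  next
    assume "\<exists>k. e = side k"
    then obtain k where k: "e = side k" ..
    \<comment> \<open>The ends are taken in reversed order: all other vertices lie to the left from
      \<open>P k\<close> to \<open>P (k + 1)\<close>, so the outer half-plane is the left one of the
      reversed line.\<close>
    have "L (P (k + 1)) (P k) = {}"
    proof (rule ccontr)
      assume "L (P (k + 1)) (P k) \<noteq> {}"
      then obtain f where f: "f \<in> M" "f \<noteq> e" "convex hull f \<subseteq> left_side (P (k + 1)) (P k)" unfolding L_def by blast
      obtain x where x: "x \<in> f" using matchingD(2)[OF M f(1)] by fastforce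
      have "x \<notin> side k" using matching_disjoint[OF M e f(1)] f(2) x k by blast
      moreover have "x \<in> circle_points n" using matchingD(1)[OF M f(1)] x by blast
      ultimately have "ori (P k) (P (k + 1)) x > 0" by (intro ori_side_pos)
      moreover have "x \<in> left_side (P (k + 1)) (P k)" using hull_inc[OF x, of convex] f(3) by blast
      ultimately show False unfolding left_side_ori using ori_swap[of "P k" "P (k + 1)" x] by simp
    qed
    then have "card (L (P (k + 1)) (P k)) = 0" by simp
    moreover have "e = {P (k + 1), P k}" using k by (auto simp: side_def)
    ultimately have "0 \<in> K" unfolding K_def by (metis (mono_tags, lifting) mem_Collect_eq)
    then have "Min K = 0" using Min_le[OF fin] by fastforce
    then show "perimeter_edge M e" using len e by (simp add: perimeter_edge_def)
  qed
qed

section \<open>Maximum degree and the vertices that attain it\<close>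

lemma max_degree_eqI:
  assumes "\<And>M. M \<in> matchings n \<Longrightarrow> card (neighbours M) \<le> k" "k \<le> card (neighbours (perimeter 0))"
  shows "max_degree (matchings n) (H_edges n) = k"
  unfolding max_degree_def
proof (rule Max_eqI)
  show "finite (vertex_degree (H_edges n) ` matchings n)" using finite_matchings by simp
  show "y \<le> k" if "y \<in> vertex_degree (H_edges n) ` matchings n" for y
    using that assms(1) vertex_degree_eq by auto
  have "card (neighbours (perimeter 0)) = k"
    using assms(1)[OF perimeter_matching] assms(2) by (rule antisym)
  then show "k \<in> vertex_degree (H_edges n) ` matchings n"
    using vertex_degree_eq[OF perimeter_matching] perimeter_matching by (metis imageI)
qed

lemma degree_n_iff:
  assumes "odd n" "n \<ge> 3" and M: "M \<in> matchings n"
  shows "vertex_degree (H_edges n) M = n \<longleftrightarrow> M = perimeter 0 \<or> M = perimeter 1"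
  unfolding vertex_degree_eq[OF M]
proof
  assume c: "card (neighbours M) = n"
  have "\<exists>k. e = side k" if e: "e \<in> M" for e
  proof -
    obtain p where p: "p \<in> e" using matchingD(2)[OF M e] by fastforce
    then obtain i where "P i \<in> e" using matchingD(1)[OF M e] circle_points_range by auto
    then have "e = {P i, P (i + 1)} \<or> e = {P (i - 1), P i}" by (rule extremal_edges_adjacent[OF M c e])
    then have "e = side i \<or> e = side (i - 1)" by (simp add: side_def)
    then show ?thesis by blast
  qed
  then show "M = perimeter 0 \<or> M = perimeter 1" using all_sides_iff[OF M] by blast
next
  assume "M = perimeter 0 \<or> M = perimeter 1"
  then show "card (neighbours M) = n"
    using perimeter_neighbours_odd[OF assms(1,2)] neighbours_bound[OF M] assms(1) by (auto intro: antisym)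
qed

end

theorem theorem4:
  fixes n :: nat
  shows "(odd n \<and> n \<ge> 3 \<longrightarrow>
            max_degree (matchings n) (H_edges n) = n \<and>
            card {M \<in> matchings n. vertex_degree (H_edges n) M = n} = 2 \<and>
            {M \<in> matchings n. vertex_degree (H_edges n) M = n} =
              {M \<in> matchings n. \<forall>e\<in>M. perimeter_edge M e}) \<and>
         (even n \<and> n \<ge> 2 \<longrightarrow>
            max_degree (matchings n) (H_edges n) = n div 2)"
proof (intro conjI[of "_ \<longrightarrow> _"] impI)
  assume n: "odd n \<and> n \<ge> 3"
  interpret polygon n by unfold_locales (use n in simp)
  have deg: "{M \<in> matchings n. vertex_degree (H_edges n) M = n} = {perimeter 0, perimeter 1}"
    using degree_n_iff n perimeter_matching by blast
  have "(\<forall>e\<in>M. perimeter_edge M e) \<longleftrightarrow> M = perimeter 0 \<or> M = perimeter 1" if "M \<in> matchings n" for M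
    using all_sides_iff[OF that] perimeter_edge_iff[OF that] by simp
  then have per: "{M \<in> matchings n. \<forall>e\<in>M. perimeter_edge M e} = {perimeter 0, perimeter 1}"
    using perimeter_matching by blast
  have "max_degree (matchings n) (H_edges n) = n"
    using neighbours_bound n by (intro max_degree_eqI perimeter_neighbours_odd) auto
  then show "max_degree (matchings n) (H_edges n) = n \<and>
      card {M \<in> matchings n. vertex_degree (H_edges n) M = n} = 2 \<and>
      {M \<in> matchings n. vertex_degree (H_edges n) M = n} =
        {M \<in> matchings n. \<forall>e\<in>M. perimeter_edge M e}"
    unfolding deg per using perimeter_0_neq_1 by simp
next
  assume n: "even n \<and> n \<ge> 2"
  interpret polygon n by unfold_locales (use n in simp)
  show "max_degree (matchings n) (H_edges n) = n div 2"
    using neighbours_bound n by (intro max_degree_eqI perimeter_neighbours_even) auto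
qed

end
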